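(* Let $(\mathcal{X},d)$ be a Polish space and $\mu\in\mathcal{P}(\mathcal{X})$. Suppose that for some constants $\lambda_o,D>0$, $H(\nu|\mu)\le D\,I(\nu|\mu)$ holds for every probability measure $\nu$ of the form $\nu(dx)=e^{f(x)}\mu(dx)$ with $f\in\mathcal{F}_{\lambda_o}(\mathcal{X})$. Then $\mu$ satisfies $\mathbf{T}_2(\max(4D,1/\lambda_o))$.
   Context: $\mathcal{F}_{\lambda_o}(\mathcal{X})$ is the set of functions $f:\mathcal{X}\to\mathbb{R}$ for which there exist $g:\mathcal{X}\to\mathbb{R}$ and $\lambda\in(0,\lambda_o)$ with $f(x)=\inf_{y\in\mathcal{X}}\{-g(y)+\lambda d^2(x,y)\}$ for all $x$. $H(\nu|\mu)=\int\log(d\nu/d\mu)\,d\nu$ for $\nu\ll\mu$ ($+\infty$ otherwise). The Fisher information is $I(\nu|\mu)=\int|\nabla^+\log(d\nu/d\mu)|^2\,d\nu$, where the local slope is $|\nabla^+g|(x)=\limsup_{y\to x}[g(y)-g(x)]_+/d(y,x)$ ($0$ at isolated points). $\mu$ satisfies $\mathbf{T}_2(C)$ if $W_2^2(\nu,\mu)\le C\,H(\nu|\mu)$ for all $\nu\in\mathcal{P}(\mathcal{X})$, with $W_2^2(\nu,\mu)=\inf_\pi\iint d^2\,d\pi$ over couplings of $\nu$ and $\mu$. *)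

theory Defs
  imports "HOL-Probability.Probability"
begin

definition prob_measures :: "('a::topological_space) measure set" where
  "prob_measures = {\<nu>. prob_space \<nu> \<and> sets \<nu> = sets borel}"

text \<open>Relative entropy H(nu|mu) = integral of log(dnu/dmu) dnu if nu << mu, +infinity otherwise.
  The negative part of the integrand has finite integral for probability measures,
  so the difference below is the (extended real) integral.\<close>
definition rel_entropy :: "'a measure \<Rightarrow> 'a measure \<Rightarrow> ereal" where
  "rel_entropy \<mu> \<nu> =
     (if absolutely_continuous \<mu> \<nu> then
        (let \<rho> = (\<lambda>x. enn2real (RN_deriv \<mu> \<nu> x)) in
          enn2ereal (\<integral>\<^sup>+ x. ennreal (max 0 (ln (\<rho> x))) \<partial>\<nu>)
          - enn2ereal (\<integral>\<^sup>+ x. ennreal (max 0 (- ln (\<rho> x))) \<partial>\<nu>))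
      else \<infinity>)"

definition local_slope :: "('a::metric_space \<Rightarrow> real) \<Rightarrow> 'a \<Rightarrow> ereal" where
  "local_slope g x =
     (if at x = bot then 0
      else Limsup (at x) (\<lambda>y. ereal (max 0 (g y - g x) / dist y x)))"

text \<open>Fisher information I(nu|mu) = integral of |nabla^+ log(dnu/dmu)|^2 dnu, for
  nu = e^f mu, with the density representative log(dnu/dmu) = f.\<close>
definition fisher_info :: "'a::metric_space measure \<Rightarrow> ('a \<Rightarrow> real) \<Rightarrow> ennreal" where
  "fisher_info \<mu> f =
     (\<integral>\<^sup>+ x. (e2ennreal (local_slope f x)) ^ 2 \<partial>(density \<mu> (\<lambda>x. ennreal (exp (f x)))))"

definition F_class :: "real \<Rightarrow> ('a::metric_space \<Rightarrow> real) set" where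
  "F_class lam0 = {f. \<exists>g::'a \<Rightarrow> real. \<exists>lam. 0 < lam \<and> lam < lam0 \<and>
      (\<forall>x. ereal (f x) = (INF y. ereal (- g y + lam * (dist x y)\<^sup>2)))}"

definition couplings :: "'a::topological_space measure \<Rightarrow> 'a measure \<Rightarrow> ('a \<times> 'a) measure set" where
  "couplings \<nu> \<mu> = {\<pi>. prob_space \<pi> \<and> sets \<pi> = sets (borel \<Otimes>\<^sub>M borel) \<and>
      distr \<pi> borel fst = \<nu> \<and> distr \<pi> borel snd = \<mu>}"

definition W2_sq :: "'a::metric_space measure \<Rightarrow> 'a measure \<Rightarrow> ennreal" where
  "W2_sq \<nu> \<mu> = (INF \<pi>\<in>couplings \<nu> \<mu>. \<integral>\<^sup>+ p. ennreal ((dist (fst p) (snd p))\<^sup>2) \<partial>\<pi>)"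

definition T2 :: "real \<Rightarrow> 'a::metric_space measure \<Rightarrow> bool" where
  "T2 C \<mu> \<longleftrightarrow> (\<forall>\<nu>\<in>prob_measures. enn2ereal (W2_sq \<nu> \<mu>) \<le> ereal C * rel_entropy \<mu> \<nu>)"

end

theory Submission
  imports Defs
begin

text \<open>For bounded f and C > max (4 D) (1 / lam0), put v t x = (INF y. t * f y + d(x, y)^2 / C).
  Up to a constant, v t lies in the class on which the logarithmic Sobolev inequality is assumed, and
  v t - t * (d/dt) v t dominates D times the squared slope of v t. Hence the log-Sobolev inequality
  for the density proportional to exp (v t) makes (1/t) * ln (integral of exp (v t)) nonincreasing in t.
  Comparing t = 1 with t tending to 0 gives integral of exp (v 1) <= exp (integral of f), which is the
  dual form of the transport inequality. It also yields Gaussian tails. The passage back to couplings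
  uses finite linear programming duality on a partition into small cells: the dual inequality for
  step functions f bounds the discrete transport cost, the discrete plan is spread over
  the product of the cells, and finite second moments control the remaining cell.\<close>

section \<open>Finite Kantorovich duality\<close>

text \<open>Writing \<open>t * f y + d(x, y)^2 / C\<close> as t times
  \<open>f y + d(x, y)^2 / (C * t)\<close> shows that v t is t times the Hopf-Lax evolution of f at
  time t. The factor t moves into f, the quadratic coefficient stays 1 / C, so v t remains in the
  class for all t. Heuristically, if y attains the infimum, then (d/dt) v t = f y and v t - t *
  (d/dt) v t = d(x, y)^2 / C, while the slope is at most 2 * d(x, y) / C. Its square is thus at most
  4 / C times that quantity, which explains the condition 4 * D <= C. With L = ln (integral of exp
  (v t)), the log-Sobolev inequality then reads (d/dt) L <= L / t. In a general Polish space no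
  minimiser need exist and v t need not be differentiable in t. Near-minimisers and forward
  difference quotients replace them, and the differential inequality becomes an Euler scheme.
  Coefficients in the class lie strictly below \<open>lam0\<close>, so C stays strictly above the
  target constant and tends to it only at the very end.\<close>

text \<open>Bartl's algebraic proof: if the constraint m is indispensable, a point z violating the conclusion
  has a m z > 0, and projecting along z onto the kernel of a m removes that constraint.\<close>

lemma farkas_functionals:
  fixes a :: "'m \<Rightarrow> ('k \<Rightarrow> real) \<Rightarrow> real" and b :: "('k \<Rightarrow> real) \<Rightarrow> real"
  assumes "finite S"
    and "\<And>i x y t. i \<in> S \<Longrightarrow> a i (\<lambda>k. x k - t * y k) = a i x - t * a i y"
    and "\<And>x y t. b (\<lambda>k. x k - t * y k) = b x - t * b y"
    and "\<And>x. (\<And>i. i \<in> S \<Longrightarrow> a i x \<le> 0) \<Longrightarrow> b x \<le> 0"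
  shows "\<exists>u. (\<forall>i\<in>S. 0 \<le> u i) \<and> (\<forall>x. b x = (\<Sum>i\<in>S. u i * a i x))"
  using assms
proof (induction S arbitrary: a b rule: finite_induct)
  case empty
  have "b x = 0" for x
  proof -
    \<comment> \<open>Without constraints \<open>b\<close> is nonpositive everywhere; since x - 2 *
      x = - x, this applies to \<open>x\<close> and to its negative.\<close>
    have "b (\<lambda>k. x k - 2 * x k) = b x - 2 * b x" by (rule empty.prems)
    with empty.prems(3)[of x] empty.prems(3)[of "\<lambda>k. x k - 2 * x k"] show ?thesis by auto
  qed
  then show ?case by auto
next
  case (insert m S)
  show ?case
  proof (cases "\<forall>x. (\<forall>i\<in>S. a i x \<le> 0) \<longrightarrow> b x \<le> 0")
    case True
    have "\<exists>u. (\<forall>i\<in>S. 0 \<le> u i) \<and> (\<forall>x. b x = (\<Sum>i\<in>S. u i * a i x))"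
      using insert.prems True by (intro insert.IH) auto
    then obtain u where u: "\<forall>i\<in>S. 0 \<le> u i" "\<forall>x. b x = (\<Sum>i\<in>S. u i * a i x)" by blast
    have "(\<Sum>i\<in>S. (u(m := 0)) i * a i x) = (\<Sum>i\<in>S. u i * a i x)" for x
      using insert.hyps by (intro sum.cong) auto
    then show ?thesis using u insert.hyps by (intro exI[of _ "u(m := 0)"]) auto
  next
    case False
    then obtain z where z: "\<And>i. i \<in> S \<Longrightarrow> a i z \<le> 0" "b z > 0" by (metis not_le)
    have mz: "a m z > 0"
      using insert.prems(3)[of z] z by (metis insertE leI not_less)
    define P where "P x = (\<lambda>k. x k - (a m x / a m z) * z k)" for x
    define a' where "a' i x = a i (P x)" for i x
    define b' where "b' x = b (P x)" for x
    have a': "a' i x = a i x - a m x / a m z * a i z" if "i \<in> insert m S" for i x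
      unfolding a'_def P_def by (rule insert.prems(1)[OF that])
    have b': "b' x = b x - a m x / a m z * b z" for x
      unfolding b'_def P_def by (rule insert.prems(2))
    have "\<exists>u. (\<forall>i\<in>S. 0 \<le> u i) \<and> (\<forall>x. b' x = (\<Sum>i\<in>S. u i * a' i x))"
    proof (rule insert.IH)
      fix i x y t assume "i \<in> S"
      then show "a' i (\<lambda>k. x k - t * y k) = a' i x - t * a' i y"
        by (simp only: a' insertI1 insertI2 insert.prems(1) diff_divide_distrib) (simp add: algebra_simps)
    next
      fix x y t
      show "b' (\<lambda>k. x k - t * y k) = b' x - t * b' y"
        by (simp only: b' insertI1 insert.prems(1) insert.prems(2) diff_divide_distrib) (simp add: algebra_simps)
    next
      fix x assume *: "\<And>i. i \<in> S \<Longrightarrow> a' i x \<le> 0"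
      have "a' m x = 0" using mz by (simp add: a')
      with * show "b' x \<le> 0"
        unfolding a'_def b'_def by (intro insert.prems(3)) auto
    qed
    then obtain u where u: "\<forall>i\<in>S. 0 \<le> u i" "\<forall>x. b' x = (\<Sum>i\<in>S. u i * a' i x)" by blast
    \<comment> \<open>Forced by solving the formula for \<open>b' x\<close> for \<open>b x\<close>
      and collecting the terms with \<open>a m x\<close>. The sign comes from
      \<open>b z > 0\<close>, \<open>a m z > 0\<close> and the nonpositive values
      \<open>a i z\<close>.\<close>
    define w where "w = (b z - (\<Sum>i\<in>S. u i * a i z)) / a m z"
    have "(\<Sum>i\<in>S. u i * a i z) \<le> 0"
      using u z by (intro sum_nonpos) (auto simp: mult_nonneg_nonpos)
    then have w: "w \<ge> 0" using z mz by (simp add: w_def)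
    have "b x = w * a m x + (\<Sum>i\<in>S. u i * a i x)" for x
    proof -
      have "(\<Sum>i\<in>S. u i * a' i x) = (\<Sum>i\<in>S. u i * a i x - a m x / a m z * (u i * a i z))"
        by (intro sum.cong) (auto simp: a' algebra_simps)
      also have "\<dots> = (\<Sum>i\<in>S. u i * a i x) - a m x / a m z * (\<Sum>i\<in>S. u i * a i z)"
        by (simp add: sum_subtractf sum_distrib_left)
      finally have "b x = a m x / a m z * b z + (\<Sum>i\<in>S. u i * a i x) - a m x / a m z * (\<Sum>i\<in>S. u i * a i z)"
        using u(2)[rule_format, of x] b'[of x] by linarith
      then show ?thesis by (simp add: w_def diff_divide_distrib algebra_simps)
    qed
    moreover have "(\<Sum>i\<in>S. (u(m := w)) i * a i x) = (\<Sum>i\<in>S. u i * a i x)" for x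
      using insert.hyps by (intro sum.cong) auto
    ultimately show ?thesis using u w insert.hyps
      by (intro exI[of _ "u(m := w)"]) auto
  qed
qed

text \<open>An extra coordinate \<open>None\<close> scaling \<open>c\<close> and \<open>K\<close>
  makes the dual bound homogeneous, so that Farkas applies. The multipliers of the pair constraints
  are the transport plan: the resulting identity at the unit vectors of \<open>Inl i\<close> and
  \<open>Inr j\<close> gives the marginals, and at that of \<open>None\<close> it says that the cost
  plus the multiplier of the sign constraint equals \<open>K\<close>.\<close>

lemma finite_kantorovich_duality:
  fixes a :: "'i \<Rightarrow> real" and b :: "'j \<Rightarrow> real" and c :: "'i \<Rightarrow> 'j \<Rightarrow> real"
  assumes fin: "finite I" "finite J"
    and nonneg: "\<And>i. i \<in> I \<Longrightarrow> 0 \<le> a i" "\<And>j. j \<in> J \<Longrightarrow> 0 \<le> b j"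
    and total: "sum a I = 1" "sum b J = 1"
    and dual: "\<And>\<phi> \<psi>. (\<And>i j. i \<in> I \<Longrightarrow> j \<in> J \<Longrightarrow> \<phi> i + \<psi> j \<le> c i j) \<Longrightarrow>
        (\<Sum>i\<in>I. \<phi> i * a i) + (\<Sum>j\<in>J. \<psi> j * b j) \<le> K"
  obtains u where "\<And>i j. i \<in> I \<Longrightarrow> j \<in> J \<Longrightarrow> 0 \<le> u i j"
    and "\<And>i. i \<in> I \<Longrightarrow> (\<Sum>j\<in>J. u i j) = a i"
    and "\<And>j. j \<in> J \<Longrightarrow> (\<Sum>i\<in>I. u i j) = b j"
    and "(\<Sum>i\<in>I. \<Sum>j\<in>J. c i j * u i j) \<le> K"
proof -
  have ne: "I \<noteq> {}" "J \<noteq> {}" using total by auto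
  define A :: "('i \<times> 'j) option \<Rightarrow> (('i + 'j) option \<Rightarrow> real) \<Rightarrow> real"
    where "A p x = (case p of None \<Rightarrow> - x None
      | Some (i, j) \<Rightarrow> x (Some (Inl i)) + x (Some (Inr j)) - c i j * x None)" for p x
  define B :: "(('i + 'j) option \<Rightarrow> real) \<Rightarrow> real"
    where "B x = (\<Sum>i\<in>I. x (Some (Inl i)) * a i) + (\<Sum>j\<in>J. x (Some (Inr j)) * b j) - K * x None" for x
  define S where "S = insert None (Some ` (I \<times> J))"
  have "\<exists>u. (\<forall>p\<in>S. 0 \<le> u p) \<and> (\<forall>x. B x = (\<Sum>p\<in>S. u p * A p x))"
  proof (rule farkas_functionals)
    show "finite S" using fin by (simp add: S_def)
    show "A p (\<lambda>k. x k - t * y k) = A p x - t * A p y" for p x y t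
      by (simp add: A_def algebra_simps split: option.split)
    show "B (\<lambda>k. x k - t * y k) = B x - t * B y" for x y t
      by (simp add: B_def algebra_simps sum_subtractf sum_distrib_left sum.distrib)
    fix x assume A: "\<And>p. p \<in> S \<Longrightarrow> A p x \<le> 0"
    define s where "s = x None"
    have s: "s \<ge> 0" using A[of None] by (simp add: S_def A_def s_def)
    have le: "x (Some (Inl i)) + x (Some (Inr j)) \<le> c i j * s" if "i \<in> I" "j \<in> J" for i j
      using A[of "Some (i, j)"] that by (simp add: S_def A_def s_def)
    show "B x \<le> 0"
    proof (cases "s = 0")
      case True
      \<comment> \<open>At scale zero \<open>dual\<close> cannot be reached by rescaling. The
        constraints now say that sums of the two families are nonpositive, so one number separates
        them, and the equal total masses cancel it.\<close>
      define m where "m = Max ((\<lambda>j. x (Some (Inr j))) ` J)"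
      have "m \<in> (\<lambda>j. x (Some (Inr j))) ` J" unfolding m_def using fin ne by (intro Max_in) auto
      then have "x (Some (Inl i)) \<le> - m" if "i \<in> I" for i
        using le that True by fastforce
      then have "(\<Sum>i\<in>I. x (Some (Inl i)) * a i) \<le> (\<Sum>i\<in>I. - m * a i)"
        using nonneg by (intro sum_mono mult_right_mono) auto
      also have "\<dots> = - m" using total by (simp flip: sum_distrib_left add: sum_negf)
      finally have 1: "(\<Sum>i\<in>I. x (Some (Inl i)) * a i) \<le> - m" .
      have "x (Some (Inr j)) \<le> m" if "j \<in> J" for j
        unfolding m_def using that fin by (intro Max_ge) auto
      then have "(\<Sum>j\<in>J. x (Some (Inr j)) * b j) \<le> (\<Sum>j\<in>J. m * b j)"
        using nonneg by (intro sum_mono mult_right_mono) auto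
      also have "\<dots> = m" using total by (simp flip: sum_distrib_left)
      finally show ?thesis using 1 True by (simp add: B_def s_def)
    next
      case False
      then have s: "s > 0" using s by simp
      have "(\<Sum>i\<in>I. x (Some (Inl i)) / s * a i) + (\<Sum>j\<in>J. x (Some (Inr j)) / s * b j) \<le> K"
        using le s by (intro dual) (simp add: field_simps)
      then have "((\<Sum>i\<in>I. x (Some (Inl i)) * a i) + (\<Sum>j\<in>J. x (Some (Inr j)) * b j)) / s \<le> K"
        by (simp add: sum_divide_distrib add_divide_distrib)
      then show ?thesis using s by (simp add: B_def s_def[symmetric] field_simps)
    qed
  qed
  then obtain u where u: "\<And>p. p \<in> S \<Longrightarrow> 0 \<le> u p" "\<And>x. B x = (\<Sum>p\<in>S. u p * A p x)" by auto
  have B: "B x = (\<Sum>i\<in>I. \<Sum>j\<in>J. u (Some (i, j)) * A (Some (i, j)) x) - u None * x None" for x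
  proof -
    have "B x = u None * A None x + (\<Sum>p\<in>Some ` (I \<times> J). u p * A p x)"
      unfolding u(2) S_def using fin by (subst sum.insert) auto
    also have "(\<Sum>p\<in>Some ` (I \<times> J). u p * A p x) = (\<Sum>(i, j)\<in>I \<times> J. u (Some (i, j)) * A (Some (i, j)) x)"
      by (subst sum.reindex) (auto intro!: sum.cong)
    finally show ?thesis by (simp add: sum.cartesian_product A_def)
  qed
  show thesis
  proof (rule that[of "\<lambda>i j. u (Some (i, j))"])
    show "0 \<le> u (Some (i, j))" if "i \<in> I" "j \<in> J" for i j
      using u(1) that by (auto simp: S_def)
    show "(\<Sum>j\<in>J. u (Some (i, j))) = a i" if "i \<in> I" for i
    proof -
      have "B (\<lambda>k. if k = Some (Inl i) then 1 else 0) = a i"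
        using fin that by (simp add: B_def if_distrib[where f="\<lambda>z. z * _"] cong: if_cong)
      then show ?thesis unfolding B using fin that
        by (simp add: A_def if_distrib[where f="\<lambda>x. _ * x"] sum.delta cong: if_cong)
          (subst (asm) sum.swap, simp)
    qed
    show "(\<Sum>i\<in>I. u (Some (i, j))) = b j" if "j \<in> J" for j
    proof -
      have "B (\<lambda>k. if k = Some (Inr j) then 1 else 0) = b j"
        using fin that by (simp add: B_def if_distrib[where f="\<lambda>z. z * _"] cong: if_cong)
      then show ?thesis unfolding B using fin that
        by (simp add: A_def if_distrib[where f="\<lambda>x. _ * x"] sum.delta cong: if_cong)
    qed
    have "B (\<lambda>k. if k = None then 1 else 0) = - K"
      by (simp add: B_def)
    then have "K = (\<Sum>i\<in>I. \<Sum>j\<in>J. c i j * u (Some (i, j))) + u None"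
      unfolding B by (simp add: A_def sum_negf algebra_simps)
    then show "(\<Sum>i\<in>I. \<Sum>j\<in>J. c i j * u (Some (i, j))) \<le> K"
      using u(1)[of None] by (simp add: S_def)
  qed
qed

section \<open>Relative entropy\<close>

lemma (in prob_space) rel_entropy_exp_density:
  fixes f :: "'a \<Rightarrow> real"
  assumes f [measurable]: "f \<in> borel_measurable M"
    and bound: "\<And>x. \<bar>f x\<bar> \<le> B"
    and prob: "prob_space (density M (\<lambda>x. ennreal (exp (f x))))"
  shows "rel_entropy M (density M (\<lambda>x. ennreal (exp (f x))))
    = ereal (\<integral>x. f x \<partial>density M (\<lambda>x. ennreal (exp (f x))))"
proof -
  let ?N = "density M (\<lambda>x. ennreal (exp (f x)))"
  interpret N: prob_space ?N by (rule prob)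
  have ac: "absolutely_continuous M ?N"
    by (intro absolutely_continuousI_density) simp
  have "AE x in M. ennreal (exp (f x)) = RN_deriv M ?N x"
    by (intro RN_deriv_unique) auto
  then have "AE x in M. ln (enn2real (RN_deriv M ?N x)) = f x"
    by eventually_elim (metis enn2real_ennreal exp_ge_zero ln_exp)
  then have AE: "AE x in ?N. ln (enn2real (RN_deriv M ?N x)) = f x"
    by (subst AE_density) auto
  have "integrable ?N (\<lambda>x. max 0 (f x))" "integrable ?N (\<lambda>x. max 0 (- f x))"
    using bound by (auto intro!: N.integrable_const_bound[where B=B] AE_I2 simp: abs_le_iff max_def)
      (smt (verit) bound)+
  moreover from this
  have "(\<integral>\<^sup>+ x. ennreal (max 0 (ln (enn2real (RN_deriv M ?N x)))) \<partial>?N) = ennreal (\<integral>x. max 0 (f x) \<partial>?N)"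
    "(\<integral>\<^sup>+ x. ennreal (max 0 (- ln (enn2real (RN_deriv M ?N x)))) \<partial>?N) = ennreal (\<integral>x. max 0 (- f x) \<partial>?N)"
    using AE by (auto simp flip: nn_integral_eq_integral intro!: nn_integral_cong_AE)
  moreover have "(\<integral>x. max 0 (f x) \<partial>?N) - (\<integral>x. max 0 (- f x) \<partial>?N) = (\<integral>x. max 0 (f x) - max 0 (- f x) \<partial>?N)"
    using calculation by simp
  moreover have "max 0 (f x) - max 0 (- f x) = f x" for x by simp
  ultimately show ?thesis
    using ac by (simp add: rel_entropy_def Let_def)
qed

lemma (in prob_space) expectation_exp_pos:
  fixes g :: "'a \<Rightarrow> real"
  assumes "g \<in> borel_measurable M" "\<And>x. \<bar>g x\<bar> \<le> K"
  shows "0 < (\<integral>x. exp (g x) \<partial>M)"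
proof -
  have "exp (- K) \<le> exp (g x)" for x using assms(2)[of x] by (simp add: abs_le_iff)
  moreover have "integrable M (\<lambda>x. exp (g x))"
    using assms by (intro integrable_const_bound[where B="exp K"]) (auto simp: abs_le_iff)
  ultimately have "exp (- K) \<le> (\<integral>x. exp (g x) \<partial>M)"
    by (intro integral_ge_const) auto
  then show ?thesis using less_le_trans exp_gt_zero by blast
qed

text \<open>Integrate \<open>ln y \<le> y - 1\<close> against \<open>N\<close> at the point
  \<open>exp (\<phi> x) / (Z * \<rho> x)\<close>. The right-hand side has integral at most 0: going
  back to \<open>M\<close> leaves the normalised exponential on the set where \<open>\<rho>\<close>
  is positive.\<close>

lemma (in prob_space) donsker_varadhan:
  fixes \<phi> :: "'a \<Rightarrow> real"
  assumes N: "prob_space N" "sets N = sets M"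
    and ac: "absolutely_continuous M N"
    and \<phi> [measurable]: "\<phi> \<in> borel_measurable M"
    and bound: "\<And>x. \<bar>\<phi> x\<bar> \<le> B"
  shows "ereal ((\<integral>x. \<phi> x \<partial>N) - ln (\<integral>x. exp (\<phi> x) \<partial>M)) \<le> rel_entropy M N"
proof -
  interpret N: prob_space N by (rule N)
  note [measurable_cong] = N(2)
  define \<rho> where "\<rho> x = enn2real (RN_deriv M N x)" for x
  have \<rho> [measurable]: "\<rho> \<in> borel_measurable M" unfolding \<rho>_def by measurable
  have \<rho>_nonneg: "\<rho> x \<ge> 0" for x by (simp add: \<rho>_def)
  have "AE x in M. RN_deriv M N x \<noteq> \<infinity>"
    using N ac N.sigma_finite_measure_axioms by (intro RN_deriv_finite)
  then have RN: "AE x in M. RN_deriv M N x = ennreal (\<rho> x)"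
    by eventually_elim (simp add: \<rho>_def less_top)
  have N_eq: "N = density M (\<lambda>x. ennreal (\<rho> x))"
    using density_RN_deriv[OF ac N(2)] RN density_cong[of "RN_deriv M N" M "\<lambda>x. ennreal (\<rho> x)"] by simp
  have pos: "AE x in N. \<rho> x > 0"
    by (subst N_eq, subst AE_density) auto
  \<comment> \<open>As \<open>\<rho> * ln (1 / \<rho>) \<le> 1\<close>, the negative part always has
    a finite integral. The difference in \<open>rel_entropy\<close> is thus never infinity minus
    infinity, and only the positive part needs a case split.\<close>
  have "(\<integral>\<^sup>+ x. ennreal (max 0 (- ln (\<rho> x))) \<partial>N) = (\<integral>\<^sup>+ x. ennreal (\<rho> x) * ennreal (max 0 (- ln (\<rho> x))) \<partial>M)"
    by (subst N_eq, subst nn_integral_density) auto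
  also have "\<dots> \<le> (\<integral>\<^sup>+ x. 1 \<partial>M)"
  proof (intro nn_integral_mono)
    fix x
    have "\<rho> x * max 0 (- ln (\<rho> x)) \<le> 1"
    proof (cases "\<rho> x = 0")
      case False
      then have p: "\<rho> x > 0" using \<rho>_nonneg[of x] by simp
      then have "- ln (\<rho> x) \<le> 1 / \<rho> x - 1"
        using ln_le_minus_one[of "1 / \<rho> x"] by (simp add: ln_div)
      then have "max 0 (- ln (\<rho> x)) \<le> 1 / \<rho> x" using p by simp
      then show ?thesis using p by (simp add: field_simps)
    qed simp
    then show "ennreal (\<rho> x) * ennreal (max 0 (- ln (\<rho> x))) \<le> 1"
      using \<rho>_nonneg by (metis ennreal_1 ennreal_leI ennreal_mult max.cobounded1)
  qed
  finally have neg: "(\<integral>\<^sup>+ x. ennreal (max 0 (- ln (\<rho> x))) \<partial>N) \<le> 1"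
    by (simp add: emeasure_space_1)
  have H: "rel_entropy M N = enn2ereal (\<integral>\<^sup>+ x. ennreal (max 0 (ln (\<rho> x))) \<partial>N)
          - enn2ereal (\<integral>\<^sup>+ x. ennreal (max 0 (- ln (\<rho> x))) \<partial>N)"
    using ac by (simp add: rel_entropy_def \<rho>_def)
  show ?thesis
  proof (cases "(\<integral>\<^sup>+ x. ennreal (max 0 (ln (\<rho> x))) \<partial>N) = \<infinity>")
    case True
    then show ?thesis using neg
      by (cases "\<integral>\<^sup>+ x. ennreal (max 0 (- ln (\<rho> x))) \<partial>N") (auto simp: H)
  next
    case False
    have i1: "integrable N (\<lambda>x. max 0 (ln (\<rho> x)))"
      using False by (intro integrableI_nonneg) (auto simp: less_top)
    have i2: "integrable N (\<lambda>x. max 0 (- ln (\<rho> x)))"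
      using neg by (intro integrableI_nonneg) (auto intro: le_less_trans)
    have max_eq: "max 0 (ln (\<rho> x)) - max 0 (- ln (\<rho> x)) = ln (\<rho> x)" for x by simp
    have il: "integrable N (\<lambda>x. ln (\<rho> x))"
      using Bochner_Integration.integrable_diff[OF i1 i2] by (simp add: max_eq)
    have "rel_entropy M N = ereal ((\<integral>x. max 0 (ln (\<rho> x)) \<partial>N) - (\<integral>x. max 0 (- ln (\<rho> x)) \<partial>N))"
      unfolding H by (subst (1 2) nn_integral_eq_integral) (simp_all add: i1 i2)
    also have "\<dots> = ereal (\<integral>x. ln (\<rho> x) \<partial>N)"
      using Bochner_Integration.integral_diff[OF i1 i2] by (simp add: max_eq)
    finally have H_eq: "rel_entropy M N = ereal (\<integral>x. ln (\<rho> x) \<partial>N)" .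
    have i\<phi>: "integrable N \<phi>"
      using bound by (intro N.integrable_const_bound[where B=B]) auto
    have ie: "integrable M (\<lambda>x. exp (\<phi> x))"
      using bound by (intro integrable_const_bound[where B="exp B"]) (auto simp: abs_le_iff)
    define Z where "Z = (\<integral>x. exp (\<phi> x) \<partial>M)"
    have Z: "Z > 0" unfolding Z_def by (rule expectation_exp_pos[OF \<phi> bound])
    have le1: "(\<integral>\<^sup>+ x. ennreal (exp (\<phi> x) / (Z * \<rho> x)) \<partial>N) \<le> 1"
    proof -
      have "(\<integral>\<^sup>+ x. ennreal (exp (\<phi> x) / (Z * \<rho> x)) \<partial>N)
          = (\<integral>\<^sup>+ x. ennreal (\<rho> x) * ennreal (exp (\<phi> x) / (Z * \<rho> x)) \<partial>M)"
        by (subst N_eq, subst nn_integral_density) auto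
      also have "\<dots> \<le> (\<integral>\<^sup>+ x. ennreal (exp (\<phi> x) / Z) \<partial>M)"
        using \<rho>_nonneg Z by (intro nn_integral_mono) (auto simp flip: ennreal_mult intro!: ennreal_leI)
      also have "\<dots> = ennreal (\<integral>x. exp (\<phi> x) / Z \<partial>M)"
        using ie Z by (intro nn_integral_eq_integral) auto
      also have "\<dots> = 1" using Z by (simp add: Z_def)
      finally show ?thesis .
    qed
    have i3: "integrable N (\<lambda>x. exp (\<phi> x) / (Z * \<rho> x))"
      using le1 \<rho>_nonneg Z by (intro integrableI_nonneg) (auto intro: le_less_trans)
    have "(\<integral>x. \<phi> x - ln Z - ln (\<rho> x) \<partial>N) \<le> (\<integral>x. exp (\<phi> x) / (Z * \<rho> x) - 1 \<partial>N)"
    proof (intro integral_mono_AE)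
      show "AE x in N. \<phi> x - ln Z - ln (\<rho> x) \<le> exp (\<phi> x) / (Z * \<rho> x) - 1"
        using pos
      proof eventually_elim
        case (elim x)
        then have "ln (exp (\<phi> x) / (Z * \<rho> x)) = \<phi> x - ln Z - ln (\<rho> x)"
          using Z by (simp add: ln_div ln_mult)
        then show ?case using ln_le_minus_one[of "exp (\<phi> x) / (Z * \<rho> x)"] elim Z by simp
      qed
    qed (use i\<phi> il i3 in auto)
    also have "\<dots> = (\<integral>x. exp (\<phi> x) / (Z * \<rho> x) \<partial>N) - 1"
      using i3 by (simp add: N.prob_space)
    also have "(\<integral>x. exp (\<phi> x) / (Z * \<rho> x) \<partial>N) \<le> 1"
      using le1 i3 \<rho>_nonneg Z by (simp add: nn_integral_eq_integral)
    finally have "(\<integral>x. \<phi> x \<partial>N) - ln Z - (\<integral>x. ln (\<rho> x) \<partial>N) \<le> 0"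
      using i\<phi> il by (simp add: N.prob_space)
    then show ?thesis by (simp add: H_eq Z_def)
  qed
qed

section \<open>Infimal convolution with the squared distance\<close>

text \<open>Compared with \<open>F_class\<close>, \<open>g\<close> has the opposite sign and
  \<open>lam\<close> is \<open>1 / C\<close>. The infimum is the conditional one of the reals,
  meaningful only for families bounded below; hence the uniform bound on \<open>g\<close> in the
  lemmas that follow.\<close>

definition quad_inf_conv :: "real \<Rightarrow> ('a::metric_space \<Rightarrow> real) \<Rightarrow> 'a \<Rightarrow> real" where
  "quad_inf_conv C g x = (INF y. g y + (dist x y)\<^sup>2 / C)"

context
  fixes C B :: real and g :: "'a::metric_space \<Rightarrow> real"
  assumes C: "C > 0" and g: "\<And>y. \<bar>g y\<bar> \<le> B"
begin

lemma bdd_below_quad_inf_conv: "bdd_below (range (\<lambda>y. g y + (dist x y)\<^sup>2 / C))"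
proof (rule bdd_belowI2)
  fix y
  have "0 \<le> (dist x y)\<^sup>2 / C" using C by simp
  then show "- B \<le> g y + (dist x y)\<^sup>2 / C" using g[of y] by linarith
qed

lemma quad_inf_conv_le: "quad_inf_conv C g x \<le> g y + (dist x y)\<^sup>2 / C"
  unfolding quad_inf_conv_def by (intro cINF_lower bdd_below_quad_inf_conv) simp

lemma quad_inf_conv_geI:
  "(\<And>y. m \<le> g y + (dist x y)\<^sup>2 / C) \<Longrightarrow> m \<le> quad_inf_conv C g x"
  unfolding quad_inf_conv_def by (intro cINF_greatest) auto

lemma quad_inf_conv_less_iff:
  "quad_inf_conv C g x < m \<longleftrightarrow> (\<exists>y. g y + (dist x y)\<^sup>2 / C < m)"
  unfolding quad_inf_conv_def by (subst cINF_less_iff) (auto simp: bdd_below_quad_inf_conv)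

lemma abs_quad_inf_conv_le: "\<bar>quad_inf_conv C g x\<bar> \<le> B"
proof -
  have "- B \<le> g y + (dist x y)\<^sup>2 / C" for y
    using g[of y] C by (smt (verit) divide_nonneg_pos zero_le_power2)
  then have "- B \<le> quad_inf_conv C g x" by (rule quad_inf_conv_geI)
  moreover have "quad_inf_conv C g x \<le> B"
    using quad_inf_conv_le[of x x] g[of x] by simp
  ultimately show ?thesis by simp
qed

text \<open>An infimum of functions continuous in \<open>x\<close> is upper semicontinuous: its
  strict sublevel sets are unions, possibly uncountable, of open sets.\<close>

lemma borel_measurable_quad_inf_conv: "quad_inf_conv C g \<in> borel_measurable borel"
proof (rule borel_measurableI_less)
  fix m
  have "{x. quad_inf_conv C g x < m} = (\<Union>y. {x. g y + (dist x y)\<^sup>2 / C < m})"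
    by (auto simp: quad_inf_conv_less_iff)
  moreover have "open (\<Union>y. {x. g y + (dist x y)\<^sup>2 / C < m})"
    by (intro open_UN ballI open_Collect_less continuous_intros) (use C in auto)
  ultimately show "{x \<in> space borel. quad_inf_conv C g x < m} \<in> sets borel" by simp
qed

text \<open>The constant is absorbed by the witness for \<open>g\<close>; it will be the logarithm
  of the normalising integral. The work lies in passing from the real infimum to the extended real
  one in \<open>F_class\<close>.\<close>

lemma quad_inf_conv_minus_const_in_F_class:
  assumes "1 / C < lam0"
  shows "(\<lambda>x. quad_inf_conv C g x - k) \<in> F_class lam0"
proof -
  have "ereal (quad_inf_conv C g x - k) = (INF y. ereal (- (k - g y) + 1 / C * (dist x y)\<^sup>2))" for x
  proof -
    have "quad_inf_conv C g x - k = (INF y. g y + (dist x y)\<^sup>2 / C - k)"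
    proof (rule antisym)
      show "quad_inf_conv C g x - k \<le> (INF y. g y + (dist x y)\<^sup>2 / C - k)"
        using quad_inf_conv_le by (intro cINF_greatest) auto
      have bdd: "bdd_below (range (\<lambda>y. g y + (dist x y)\<^sup>2 / C - k))"
        using quad_inf_conv_le[of x] by (intro bdd_belowI2[where m="quad_inf_conv C g x - k"]) simp
      have "(INF y. g y + (dist x y)\<^sup>2 / C - k) + k \<le> quad_inf_conv C g x"
        using cINF_lower[OF bdd] by (intro quad_inf_conv_geI) (simp add: le_diff_eq[symmetric])
      then show "(INF y. g y + (dist x y)\<^sup>2 / C - k) \<le> quad_inf_conv C g x - k" by simp
    qed
    moreover have "bdd_below (range (\<lambda>y. g y + (dist x y)\<^sup>2 / C - k))"
      using quad_inf_conv_le[of x] by (intro bdd_belowI2[where m="quad_inf_conv C g x - k"]) simp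
    ultimately show ?thesis
      by (simp add: ereal_Inf' image_comp algebra_simps)
  qed
  note F_eq = this
  show ?thesis
    unfolding F_class_def
    by (intro CollectI exI[of _ "\<lambda>y. k - g y"] exI[of _ "1 / C"] conjI allI F_eq) (use C assms in auto)
qed

end

text \<open>A point almost attaining the infimum at time t bounds the convolution from above at all times s,
  and its distance to x bounds the ascending slope at time t. Comparing the two avoids both
  exact minimisers and a derivative in t.\<close>

lemma local_slope_quad_inf_conv:
  fixes f :: "'a::metric_space \<Rightarrow> real"
  assumes C: "C > 0" and f: "\<And>y. \<bar>f y\<bar> \<le> B" and t: "0 < t" "t < s"
  defines "v \<equiv> \<lambda>r. quad_inf_conv C (\<lambda>y. r * f y)"
  defines "R \<equiv> \<lambda>x. v t x - t * ((v s x - v t x) / (s - t))"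
  shows "0 \<le> R x" and "(e2ennreal (local_slope (v t) x))\<^sup>2 \<le> ennreal (4 / C * R x)"
proof -
  have bnd: "\<bar>r * f y\<bar> \<le> r * B" if "r > 0" for r y
    using f[of y] that by (simp add: abs_mult)
  have le: "v r z \<le> r * f y + (dist z y)\<^sup>2 / C" if "r > 0" for r z y
    unfolding v_def by (rule quad_inf_conv_le[OF C bnd[OF that]])
  have s: "s > 0" using t by simp
  \<comment> \<open>The near-minimiser loses \<open>\<epsilon>\<close> at time \<open>t\<close> and
    a further \<open>t * (\<epsilon> / (s - t))\<close> through the difference quotient;
    \<open>\<kappa>\<close> adds the two factors.\<close>
  define \<kappa> where "\<kappa> = s / (s - t)"
  have approx: "\<exists>y. t * f y + (dist x y)\<^sup>2 / C < v t x + \<epsilon> \<and> (dist x y)\<^sup>2 / C \<le> R x + \<kappa> * \<epsilon>"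
    if \<epsilon>: "\<epsilon> > 0" for \<epsilon>
  proof -
    obtain y where y: "t * f y + (dist x y)\<^sup>2 / C < v t x + \<epsilon>"
      using quad_inf_conv_less_iff[where g="\<lambda>y. t * f y", OF C bnd[OF t(1)], where x=x and m="v t x + \<epsilon>"] \<epsilon> by (auto simp: v_def)
    have "v s x \<le> s * f y + (dist x y)\<^sup>2 / C" by (rule le[OF s])
    then have "v s x - v t x \<le> (s - t) * f y + \<epsilon>" using y by (simp add: algebra_simps)
    then have "(v s x - v t x) / (s - t) \<le> ((s - t) * f y + \<epsilon>) / (s - t)"
      using t by (intro divide_right_mono) auto
    also have "\<dots> = f y + \<epsilon> / (s - t)" using t by (simp add: add_divide_distrib)
    finally have "(v s x - v t x) / (s - t) \<le> f y + \<epsilon> / (s - t)" .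
    then have "t * ((v s x - v t x) / (s - t)) \<le> t * (f y + \<epsilon> / (s - t))"
      using t by (intro mult_left_mono) auto
    moreover have "\<kappa> * \<epsilon> = \<epsilon> + t * (\<epsilon> / (s - t))" using t by (simp add: \<kappa>_def field_simps)
    ultimately have "(dist x y)\<^sup>2 / C \<le> R x + \<kappa> * \<epsilon>"
      using y by (simp add: R_def algebra_simps)
    with y show ?thesis by blast
  qed
  show R: "0 \<le> R x"
  proof (rule tendsto_lowerbound)
    show "((\<lambda>\<epsilon>. R x + \<kappa> * \<epsilon>) \<longlongrightarrow> R x) (at_right 0)"
      by (auto intro!: tendsto_eq_intros)
    have "0 \<le> R x + \<kappa> * \<epsilon>" if "\<epsilon> > 0" for \<epsilon>
      using approx[OF that] C by (smt (verit) divide_nonneg_pos zero_le_power2)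
    then show "\<forall>\<^sub>F \<epsilon> in at_right 0. 0 \<le> R x + \<kappa> * \<epsilon>"
      by (auto simp: eventually_at_right_less intro: eventually_mono[OF eventually_at_right_less])
  qed simp
  \<comment> \<open>A near-minimiser \<open>y\<close> has
    \<open>dist x y \<le> sqrt (C * R x)\<close> up to an error vanishing with
    \<open>\<epsilon>\<close>. Testing the infimum at \<open>z\<close> with the same
    \<open>y\<close> leaves the cross term \<open>2 * dist x y * dist z x\<close> of the squared
    triangle inequality. The final estimate does not mention \<open>y\<close>, so
    \<open>\<epsilon>\<close> may tend to 0 for each fixed \<open>z\<close>.\<close>
  define K where "K = 2 * sqrt (C * R x)"
  have K: "K \<ge> 0" using R C by (simp add: K_def)
  have incr: "v t z - v t x \<le> (K * dist z x + (dist z x)\<^sup>2) / C" for z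
  proof (rule tendsto_lowerbound)
    show "((\<lambda>\<epsilon>. \<epsilon> + (2 * sqrt (C * (R x + \<kappa> * \<epsilon>)) * dist z x + (dist z x)\<^sup>2) / C)
        \<longlongrightarrow> (K * dist z x + (dist z x)\<^sup>2) / C) (at_right 0)"
      using C by (auto intro!: tendsto_eq_intros simp: K_def)
    have "v t z - v t x \<le> \<epsilon> + (2 * sqrt (C * (R x + \<kappa> * \<epsilon>)) * dist z x + (dist z x)\<^sup>2) / C"
      if \<epsilon>: "\<epsilon> > 0" for \<epsilon>
    proof -
      obtain y where y: "t * f y + (dist x y)\<^sup>2 / C < v t x + \<epsilon>" "(dist x y)\<^sup>2 / C \<le> R x + \<kappa> * \<epsilon>"
        using approx[OF \<epsilon>] by blast
      have "dist x y \<le> sqrt (C * (R x + \<kappa> * \<epsilon>))"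
        using y(2) C by (intro real_le_rsqrt) (simp add: field_simps)
      then have "dist x y * dist z x \<le> sqrt (C * (R x + \<kappa> * \<epsilon>)) * dist z x"
        by (intro mult_right_mono) auto
      moreover have "(dist z y)\<^sup>2 \<le> (dist z x + dist x y)\<^sup>2"
        by (intro power_mono dist_triangle) auto
      ultimately have "(dist z y)\<^sup>2 \<le> (dist x y)\<^sup>2 + 2 * sqrt (C * (R x + \<kappa> * \<epsilon>)) * dist z x + (dist z x)\<^sup>2"
        by (simp add: power2_sum algebra_simps)
      then have "(dist z y)\<^sup>2 / C \<le> (dist x y)\<^sup>2 / C + (2 * sqrt (C * (R x + \<kappa> * \<epsilon>)) * dist z x + (dist z x)\<^sup>2) / C"
        using C by (simp add: divide_right_mono flip: add_divide_distrib)
      moreover have "v t z \<le> t * f y + (dist z y)\<^sup>2 / C" by (rule le[OF t(1)])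
      ultimately show ?thesis using y(1) by linarith
    qed
    then show "\<forall>\<^sub>F \<epsilon> in at_right 0.
        v t z - v t x \<le> \<epsilon> + (2 * sqrt (C * (R x + \<kappa> * \<epsilon>)) * dist z x + (dist z x)\<^sup>2) / C"
      by (auto intro: eventually_mono[OF eventually_at_right_less])
  qed simp
  have slope: "local_slope (v t) x \<le> ereal (K / C)"
  proof (cases "at x = bot")
    case True
    then show ?thesis using K C by (simp add: local_slope_def)
  next
    case False
    have "Limsup (at x) (\<lambda>z. ereal (max 0 (v t z - v t x) / dist z x))
        \<le> Limsup (at x) (\<lambda>z. ereal ((K + dist z x) / C))"
    proof (intro Limsup_mono)
      have "max 0 (v t z - v t x) / dist z x \<le> (K + dist z x) / C" if "z \<noteq> x" for z
      proof -
        have "max 0 (v t z - v t x) \<le> (K * dist z x + (dist z x)\<^sup>2) / C"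
          using incr[of z] K C by simp
        then have "max 0 (v t z - v t x) / dist z x \<le> (K * dist z x + (dist z x)\<^sup>2) / C / dist z x"
          by (intro divide_right_mono) auto
        also have "\<dots> = (K + dist z x) / C" using that C by (simp add: field_simps power2_eq_square)
        finally show ?thesis .
      qed
      then show "\<forall>\<^sub>F z in at x. ereal (max 0 (v t z - v t x) / dist z x) \<le> ereal ((K + dist z x) / C)"
        by (auto simp: eventually_at_filter)
    qed
    also have "\<dots> = ereal (K / C)"
    proof (intro lim_imp_Limsup False)
      show "((\<lambda>z. ereal ((K + dist z x) / C)) \<longlongrightarrow> ereal (K / C)) (at x)"
        using C by (auto intro!: tendsto_eq_intros)
    qed
    finally show ?thesis using False by (simp add: local_slope_def)
  qed
  have "(e2ennreal (local_slope (v t) x))\<^sup>2 \<le> (ennreal (K / C))\<^sup>2"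
    using e2ennreal_mono[OF slope] by (intro power_mono) auto
  also have "\<dots> = ennreal ((K / C)\<^sup>2)"
    using K C by (intro ennreal_power) simp
  also have "(K / C)\<^sup>2 = 4 / C * R x"
    using C R by (simp add: K_def power_divide power_mult_distrib) (simp add: power2_eq_square)
  finally show "(e2ennreal (local_slope (v t) x))\<^sup>2 \<le> ennreal (4 / C * R x)" .
qed

section \<open>The dual inequality\<close>

text \<open>For negative \<open>x\<close>, \<open>exp x \<le> 1 / (1 - x)\<close>, and (1 + x + x^2)
  * (1 - x) = 1 - x^3 is at least 1. This supplies the second-order error terms of the Euler
  scheme.\<close>

lemma exp_le_quadratic:
  fixes x :: real
  assumes "\<bar>x\<bar> \<le> 1"
  shows "exp x \<le> 1 + x + x\<^sup>2"
proof (cases "x \<ge> 0")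
  case True
  then show ?thesis using exp_bound[of x] assms by simp
next
  case False
  have "exp (- x) \<ge> 1 - x" using exp_ge_add_one_self[of "- x"] by simp
  then have "exp x \<le> 1 / (1 - x)"
    using False by (simp add: exp_minus field_simps)
  also have "\<dots> \<le> 1 + x + x\<^sup>2"
  proof -
    have "x ^ 3 \<le> 0" using False by (simp add: power3_eq_cube mult_nonneg_nonpos mult_nonpos_nonpos)
    then have "1 \<le> (1 + x + x\<^sup>2) * (1 - x)" by (simp add: algebra_simps power2_eq_square power3_eq_cube)
    then show ?thesis using False by (simp add: field_simps)
  qed
  finally show ?thesis .
qed

locale restricted_log_sobolev = prob_space \<mu>
  for \<mu> :: "'a::polish_space measure" +
  fixes lam0 D C :: real
  assumes sets_eq [measurable_cong]: "sets \<mu> = sets borel"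
    and D_pos: "0 < D" and D_le: "4 * D \<le> C" and C_lam0: "1 / C < lam0"
    and log_sobolev: "f \<in> F_class lam0 \<Longrightarrow>
           prob_space (density \<mu> (\<lambda>x. ennreal (exp (f x)))) \<Longrightarrow>
           rel_entropy \<mu> (density \<mu> (\<lambda>x. ennreal (exp (f x))))
             \<le> ereal D * enn2ereal (fisher_info \<mu> f)"
begin

lemma C_pos: "C > 0" using D_pos D_le by simp

context
  fixes f :: "'a \<Rightarrow> real" and B :: real
  assumes f [measurable]: "f \<in> borel_measurable borel" and f_le: "\<And>y. \<bar>f y\<bar> \<le> B" and B_pos: "B > 0"
begin

definition scaled_conv where "scaled_conv t = quad_inf_conv C (\<lambda>y. t * f y)"

definition log_partition where "log_partition t = ln (\<integral>x. exp (scaled_conv t x) \<partial>\<mu>)"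

lemma scaled_le: "t > 0 \<Longrightarrow> \<bar>t * f y\<bar> \<le> t * B"
  using f_le[of y] by (simp add: abs_mult)

lemma scaled_conv_bound: "t > 0 \<Longrightarrow> \<bar>scaled_conv t x\<bar> \<le> t * B"
  unfolding scaled_conv_def by (rule abs_quad_inf_conv_le[OF C_pos scaled_le])

lemma scaled_conv_measurable: "t > 0 \<Longrightarrow> scaled_conv t \<in> borel_measurable borel"
  unfolding scaled_conv_def by (rule borel_measurable_quad_inf_conv[OF C_pos scaled_le])

lemma scaled_conv_le: "t > 0 \<Longrightarrow> scaled_conv t x \<le> t * f y + (dist x y)\<^sup>2 / C"
  unfolding scaled_conv_def by (rule quad_inf_conv_le[OF C_pos scaled_le])

text \<open>For each \<open>y\<close> the competitor is affine in \<open>t\<close> with slope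
  \<open>f y\<close>, hence \<open>B\<close>-Lipschitz, and an infimum inherits a common Lipschitz
  constant.\<close>

lemma scaled_conv_increment:
  assumes "0 < t" "0 < h"
  shows "\<bar>scaled_conv (t + h) x - scaled_conv t x\<bar> \<le> h * B"
proof -
  have "scaled_conv t x - h * B \<le> scaled_conv (t + h) x"
    unfolding scaled_conv_def
  proof (rule quad_inf_conv_geI[OF C_pos scaled_le])
    show "0 < t + h" using assms by simp
    fix y
    have "scaled_conv t x \<le> t * f y + (dist x y)\<^sup>2 / C"
      by (rule scaled_conv_le[OF assms(1)])
    then show "quad_inf_conv C (\<lambda>y. t * f y) x - h * B \<le> (t + h) * f y + (dist x y)\<^sup>2 / C"
      using scaled_le[OF assms(2), of y] by (simp add: scaled_conv_def algebra_simps abs_le_iff)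
  qed
  moreover have "scaled_conv (t + h) x - h * B \<le> scaled_conv t x"
    unfolding scaled_conv_def
  proof (rule quad_inf_conv_geI[OF C_pos scaled_le[OF assms(1)]])
    fix y
    have "0 < t + h" using assms by simp
    then have "scaled_conv (t + h) x \<le> (t + h) * f y + (dist x y)\<^sup>2 / C"
      by (rule scaled_conv_le)
    then show "quad_inf_conv C (\<lambda>y. (t + h) * f y) x - h * B \<le> t * f y + (dist x y)\<^sup>2 / C"
      using scaled_le[OF assms(2), of y] by (simp add: scaled_conv_def algebra_simps abs_le_iff)
  qed
  ultimately show ?thesis by simp
qed

lemma integrable_exp_scaled_conv: "t > 0 \<Longrightarrow> integrable \<mu> (\<lambda>x. exp (scaled_conv t x))"
  using scaled_conv_bound[of t] scaled_conv_measurable[of t]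
  by (intro integrable_const_bound[where B="exp (t * B)"]) (auto simp: abs_le_iff)

lemma exp_log_partition: "t > 0 \<Longrightarrow> exp (log_partition t) = (\<integral>x. exp (scaled_conv t x) \<partial>\<mu>)"
  unfolding log_partition_def using expectation_exp_pos[OF _ scaled_conv_bound, of t] scaled_conv_measurable[of t] by simp

text \<open>A forward Euler step for L' <= L / t. The entropy of the Gibbs measure \<open>N\<close>
  is the mean of \<open>scaled_conv t\<close> minus \<open>log_partition t\<close>. The log-Sobolev
  inequality and the slope bound make it at most the mean of \<open>scaled_conv t\<close> minus
  \<open>t\<close> times the mean of \<open>q\<close>. The common term cancels, so \<open>q\<close>
  has mean at most \<open>log_partition t / t\<close>. The increment of \<open>log_partition\<close>
  is the logarithm of the \<open>N\<close>-mean of \<open>exp (h * q)\<close>, which that mean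
  controls up to second order.\<close>

lemma log_partition_step:
  assumes t: "0 < t" and h: "0 < h" "h * B \<le> 1"
  shows "log_partition (t + h) \<le> log_partition t + h * log_partition t / t + h\<^sup>2 * B\<^sup>2"
proof -
  have th: "0 < t + h" using t h by simp
  note [measurable] = scaled_conv_measurable[OF t] scaled_conv_measurable[OF th]
  define w where "w x = scaled_conv t x - log_partition t" for x
  define q where "q x = (scaled_conv (t + h) x - scaled_conv t x) / h" for x
  have w_meas [measurable]: "w \<in> borel_measurable borel" unfolding w_def by measurable
  have q_meas [measurable]: "q \<in> borel_measurable borel" unfolding q_def by measurable
  have w_bound: "\<bar>w x\<bar> \<le> t * B + \<bar>log_partition t\<bar>" for x
    using scaled_conv_bound[OF t, of x] by (simp add: w_def)
  have q_bound: "\<bar>q x\<bar> \<le> B" for x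
    using scaled_conv_increment[OF t h(1), of x] h by (simp add: q_def field_simps)
  define N where "N = density \<mu> (\<lambda>x. ennreal (exp (w x)))"
  have N_sets [measurable_cong]: "sets N = sets borel" by (simp add: N_def sets_eq)
  have exp_w: "exp (w x) = exp (scaled_conv t x) / exp (log_partition t)" for x
    by (simp add: w_def exp_diff)
  have N_int: "(\<integral>x. g x \<partial>N) = (\<integral>x. exp (w x) * g x \<partial>\<mu>)"
    if "g \<in> borel_measurable borel" for g :: "'a \<Rightarrow> real"
    unfolding N_def using that by (subst integral_density) auto
  have "emeasure N (space N) = (\<integral>\<^sup>+ x. ennreal (exp (w x)) \<partial>\<mu>)"
    unfolding N_def by (subst emeasure_density) (auto intro!: nn_integral_cong)
  also have "\<dots> = ennreal (\<integral>x. exp (w x) \<partial>\<mu>)"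
    using integrable_exp_scaled_conv[OF t] by (intro nn_integral_eq_integral) (auto simp: exp_w)
  also have "\<dots> = 1" using exp_log_partition[OF t] by (simp add: exp_w) (metis divide_self_if exp_not_eq_zero ennreal_1)
  finally have "prob_space N" by (rule prob_spaceI)
  interpret N: prob_space N by fact
  have N_integrable: "integrable N g" if "g \<in> borel_measurable borel" "\<And>x. \<bar>g x\<bar> \<le> K"
    for g :: "'a \<Rightarrow> real" and K
    using that by (intro N.integrable_const_bound[where B=K]) auto
  have iw: "integrable N w" by (rule N_integrable[OF w_meas w_bound])
  have iq: "integrable N q" by (rule N_integrable[OF q_meas q_bound])
  have ent: "rel_entropy \<mu> N = ereal (\<integral>x. w x \<partial>N)"
    unfolding N_def using w_bound \<open>prob_space N\<close> by (intro rel_entropy_exp_density) (auto simp: N_def)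
  have lsi: "rel_entropy \<mu> N \<le> ereal D * enn2ereal (fisher_info \<mu> w)"
    unfolding N_def
  proof (rule log_sobolev)
    show "w \<in> F_class lam0"
      unfolding w_def scaled_conv_def
      by (rule quad_inf_conv_minus_const_in_F_class[OF C_pos scaled_le[OF t] C_lam0])
    show "prob_space (density \<mu> (\<lambda>x. ennreal (exp (w x))))" using \<open>prob_space N\<close> by (simp add: N_def)
  qed
  \<comment> \<open>Choosing \<open>s = t + h\<close> in the slope bound turns its difference
    quotient into \<open>q\<close>.\<close>
  have R: "0 \<le> scaled_conv t x - t * q x" "(e2ennreal (local_slope (scaled_conv t) x))\<^sup>2 \<le> ennreal (4 / C * (scaled_conv t x - t * q x))" for x
    using local_slope_quad_inf_conv[where f=f and x=x and s="t + h", OF C_pos f_le t] h by (simp_all add: scaled_conv_def q_def)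
  have slope_w: "local_slope w x = local_slope (scaled_conv t) x" for x
    by (simp add: local_slope_def w_def)
  have iv: "integrable N (scaled_conv t)" by (rule N_integrable[OF scaled_conv_measurable[OF t] scaled_conv_bound[OF t]])
  have "fisher_info \<mu> w \<le> (\<integral>\<^sup>+ x. ennreal (4 / C * (scaled_conv t x - t * q x)) \<partial>N)"
    unfolding fisher_info_def N_def[symmetric] slope_w by (intro nn_integral_mono R)
  also have "\<dots> = ennreal (\<integral>x. 4 / C * (scaled_conv t x - t * q x) \<partial>N)"
    using R(1) C_pos iv iq by (intro nn_integral_eq_integral AE_I2) auto
  also have "(\<integral>x. 4 / C * (scaled_conv t x - t * q x) \<partial>N) = 4 / C * ((\<integral>x. scaled_conv t x \<partial>N) - t * (\<integral>x. q x \<partial>N))"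
    using iv iq by simp
  finally have fisher: "fisher_info \<mu> w \<le> ennreal (4 / C * ((\<integral>x. scaled_conv t x \<partial>N) - t * (\<integral>x. q x \<partial>N)))" .
  define E where "E = (\<integral>x. scaled_conv t x \<partial>N) - t * (\<integral>x. q x \<partial>N)"
  have "E = (\<integral>x. scaled_conv t x - t * q x \<partial>N)" using iv iq by (simp add: E_def)
  also have "\<dots> \<ge> 0" using R(1) by (intro integral_nonneg_AE) auto
  finally have E: "E \<ge> 0" .
  have "enn2ereal (fisher_info \<mu> w) \<le> enn2ereal (ennreal (4 / C * E))"
    using fisher by (simp add: E_def less_eq_ennreal.rep_eq)
  also have "\<dots> = ereal (4 / C * E)" using E C_pos by simp
  finally have "ereal D * enn2ereal (fisher_info \<mu> w) \<le> ereal D * ereal (4 / C * E)"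
    using D_pos by (intro ereal_mult_left_mono) auto
  then have "ereal (\<integral>x. w x \<partial>N) \<le> ereal (D * (4 / C * E))"
    unfolding ent[symmetric] times_ereal.simps by (rule order_trans[OF lsi])
  then have "(\<integral>x. w x \<partial>N) \<le> D * (4 / C * E)" by simp
  also have "\<dots> = (4 * D / C) * E" by simp
  \<comment> \<open>Here \<open>4 * D \<le> C\<close> is spent, the 4 being that of the squared
    slope bound; the sign of \<open>E\<close> permits it.\<close>
  also have "\<dots> \<le> 1 * E" using D_le C_pos E by (intro mult_right_mono) auto
  finally have "(\<integral>x. scaled_conv t x \<partial>N) - log_partition t \<le> (\<integral>x. scaled_conv t x \<partial>N) - t * (\<integral>x. q x \<partial>N)"
    using iv by (simp add: E_def w_def N.prob_space)
  then have q_int: "(\<integral>x. q x \<partial>N) \<le> log_partition t / t" using t by (simp add: field_simps)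
  have "exp (log_partition (t + h)) = (\<integral>x. exp (scaled_conv (t + h) x) \<partial>\<mu>)" by (rule exp_log_partition[OF th])
  also have "\<dots> = (\<integral>x. exp (log_partition t) * (exp (w x) * exp (h * q x)) \<partial>\<mu>)"
    using h by (intro Bochner_Integration.integral_cong) (auto simp: w_def q_def simp flip: exp_add)
  also have "\<dots> = exp (log_partition t) * (\<integral>x. exp (h * q x) \<partial>N)"
    by (subst N_int) auto
  also have "(\<integral>x. exp (h * q x) \<partial>N) \<le> (\<integral>x. 1 + h * q x + h\<^sup>2 * B\<^sup>2 \<partial>N)"
  proof (intro integral_mono)
    \<comment> \<open>\<open>h * B \<le> 1\<close> confines the exponent to the interval covered by
      \<open>exp_le_quadratic\<close>.\<close>
    have hq: "\<bar>h * q x\<bar> \<le> h * B" for x using q_bound[of x] h by (simp add: abs_mult)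
    show "integrable N (\<lambda>x. exp (h * q x))"
      using hq by (intro N.integrable_const_bound[where B="exp (h * B)"]) (auto simp: abs_le_iff)
    show "integrable N (\<lambda>x. 1 + h * q x + h\<^sup>2 * B\<^sup>2)" using iq by simp
    fix x
    have "exp (h * q x) \<le> 1 + h * q x + (h * q x)\<^sup>2"
      using hq[of x] h by (intro exp_le_quadratic) simp
    also have "(h * q x)\<^sup>2 \<le> (h * B)\<^sup>2" using hq[of x] by (metis abs_ge_zero power2_abs power_mono)
    finally show "exp (h * q x) \<le> 1 + h * q x + h\<^sup>2 * B\<^sup>2" by (simp add: power_mult_distrib)
  qed
  also have "(\<integral>x. 1 + h * q x + h\<^sup>2 * B\<^sup>2 \<partial>N) = 1 + (h * (\<integral>x. q x \<partial>N) + h\<^sup>2 * B\<^sup>2)"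
    using iq by (simp add: N.prob_space)
  also have "\<dots> \<le> 1 + (h * (log_partition t / t) + h\<^sup>2 * B\<^sup>2)"
    using mult_left_mono[OF q_int, of h] h by simp
  also have "\<dots> \<le> exp (h * (log_partition t / t) + h\<^sup>2 * B\<^sup>2)" by (rule exp_ge_add_one_self)
  finally have "exp (log_partition (t + h)) \<le> exp (log_partition t + (h * (log_partition t / t) + h\<^sup>2 * B\<^sup>2))"
    by (simp add: exp_add)
  then show ?thesis by simp
qed

text \<open>Taking \<open>y = x\<close> in the infimum gives
  \<open>scaled_conv t x \<le> t * f x\<close>; a second-order expansion of the exponential then
  bounds the starting value of the Euler scheme, with an error of order t after the
  division.\<close>

lemma log_partition_small:
  assumes t: "0 < t" "t * B \<le> 1"
  shows "log_partition t / t \<le> (\<integral>x. f x \<partial>\<mu>) + t * B\<^sup>2"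
proof -
  have if': "integrable \<mu> f" using f_le by (intro integrable_const_bound[where B=B]) auto
  have "exp (log_partition t) = (\<integral>x. exp (scaled_conv t x) \<partial>\<mu>)" by (rule exp_log_partition[OF t(1)])
  also have "\<dots> \<le> (\<integral>x. 1 + t * f x + t\<^sup>2 * B\<^sup>2 \<partial>\<mu>)"
  proof (intro integral_mono integrable_exp_scaled_conv t)
    show "integrable \<mu> (\<lambda>x. 1 + t * f x + t\<^sup>2 * B\<^sup>2)" using if' by simp
    fix x
    have "scaled_conv t x \<le> t * f x"
      using scaled_conv_le[OF t(1), of x x] by simp
    then have "exp (scaled_conv t x) \<le> exp (t * f x)" by simp
    also have "\<dots> \<le> 1 + t * f x + (t * f x)\<^sup>2"
      using scaled_le[OF t(1), of x] t by (intro exp_le_quadratic) simp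
    also have "(t * f x)\<^sup>2 \<le> (t * B)\<^sup>2"
      using scaled_le[OF t(1), of x] by (metis abs_ge_zero power2_abs power_mono)
    finally show "exp (scaled_conv t x) \<le> 1 + t * f x + t\<^sup>2 * B\<^sup>2" by (simp add: power_mult_distrib)
  qed
  also have "\<dots> = 1 + (t * (\<integral>x. f x \<partial>\<mu>) + t\<^sup>2 * B\<^sup>2)" using if' by (simp add: prob_space)
  also have "\<dots> \<le> exp (t * (\<integral>x. f x \<partial>\<mu>) + t\<^sup>2 * B\<^sup>2)" by (rule exp_ge_add_one_self)
  finally have "log_partition t \<le> t * (\<integral>x. f x \<partial>\<mu>) + t\<^sup>2 * B\<^sup>2" by simp
  then show ?thesis using t by (simp add: field_simps power2_eq_square)
qed

text \<open>In the quantity \<open>log_partition t / t\<close> the linear part of a step is exactly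
  constant, so only quadratic errors accumulate: \<open>n\<close> steps of length
  \<open>(1 - d) / n\<close> cost \<open>n * (h\<^sup>2 * B\<^sup>2 / d)\<close>, which is of order
  1 / n. Starting at \<open>d > 0\<close> keeps the division by \<open>t\<close> under
  control.\<close>

lemma log_partition_one_le:
  assumes d: "0 < d" "d < 1"
  shows "log_partition 1 \<le> log_partition d / d"
proof (rule tendsto_lowerbound)
  let ?u = "\<lambda>n::nat. log_partition d / d + (1 - d)\<^sup>2 * B\<^sup>2 / d / real n"
  show "?u \<longlonglongrightarrow> log_partition d / d"
    using tendsto_add[OF tendsto_const lim_const_over_n, of "log_partition d / d" "(1 - d)\<^sup>2 * B\<^sup>2 / d"] by simp
  show "\<forall>\<^sub>F n in sequentially. log_partition 1 \<le> ?u n"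
    \<comment> \<open>Past this threshold \<open>n \<ge> B\<close>, hence
      \<open>h * B \<le> 1\<close> as each step requires.\<close>
    using eventually_ge_at_top[of "nat \<lceil>B\<rceil> + 1"]
  proof eventually_elim
    case (elim n)
    then have n: "real n > 0" "real n \<ge> B" by linarith+
    define h where "h = (1 - d) / real n"
    have h: "h > 0" using n d by (simp add: h_def)
    have "(1 - d) * B \<le> 1 * B" using d B_pos by (intro mult_right_mono) auto
    then have hB: "h * B \<le> 1" using n by (simp add: h_def field_simps)
    have "log_partition (d + real k * h) / (d + real k * h) \<le> log_partition d / d + real k * (h\<^sup>2 * B\<^sup>2 / d)" for k
    proof (induction k)
      case 0
      then show ?case by simp
    next
      case (Suc k)
      define t where "t = d + real k * h"
      have t: "t \<ge> d" "t > 0" using d h by (auto simp: t_def add_pos_nonneg)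
      have eq: "d + real (Suc k) * h = t + h" by (simp add: t_def algebra_simps)
      have "log_partition (t + h) \<le> log_partition t + h * log_partition t / t + h\<^sup>2 * B\<^sup>2"
        by (rule log_partition_step[OF t(2) h hB])
      also have "\<dots> = (t + h) * (log_partition t / t) + h\<^sup>2 * B\<^sup>2" using t by (simp add: field_simps)
      finally have "log_partition (t + h) / (t + h) \<le> ((t + h) * (log_partition t / t) + h\<^sup>2 * B\<^sup>2) / (t + h)"
        using t h by (intro divide_right_mono) auto
      also have "\<dots> = log_partition t / t + h\<^sup>2 * B\<^sup>2 / (t + h)"
        using t h by (simp add: add_divide_distrib)
      also have "h\<^sup>2 * B\<^sup>2 / (t + h) \<le> h\<^sup>2 * B\<^sup>2 / d"
        using t h d by (intro divide_left_mono) auto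
      finally have "log_partition (t + h) / (t + h) \<le> log_partition t / t + h\<^sup>2 * B\<^sup>2 / d" by simp
      moreover have "real (Suc k) * (h\<^sup>2 * B\<^sup>2 / d) = real k * (h\<^sup>2 * B\<^sup>2 / d) + h\<^sup>2 * B\<^sup>2 / d"
        by (simp only: of_nat_Suc distrib_right mult_1_left)
      ultimately show ?case using Suc.IH unfolding eq t_def[symmetric] by linarith
    qed
    from this[of n] have "log_partition 1 \<le> log_partition d / d + real n * (h\<^sup>2 * B\<^sup>2 / d)"
      using n by (simp add: h_def)
    also have "real n * (h\<^sup>2 * B\<^sup>2 / d) = (1 - d)\<^sup>2 * B\<^sup>2 / d / real n"
      using n d by (simp add: h_def field_simps power2_eq_square)
    finally show ?case .
  qed
qed simp

lemma dual_inequality: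
  "(\<integral>x. exp (quad_inf_conv C f x) \<partial>\<mu>) \<le> exp (\<integral>x. f x \<partial>\<mu>)"
proof -
  have "log_partition 1 \<le> (\<integral>x. f x \<partial>\<mu>)"
  proof (rule tendsto_lowerbound)
    show "((\<lambda>d. (\<integral>x. f x \<partial>\<mu>) + d * B\<^sup>2) \<longlongrightarrow> (\<integral>x. f x \<partial>\<mu>)) (at_right 0)"
      by (auto intro!: tendsto_eq_intros)
    have "\<forall>\<^sub>F d in at_right (0::real). d < min 1 (1 / B)"
      using B_pos by (intro eventually_mono[OF eventually_at_right_real[of 0 "min 1 (1 / B)"]]) auto
    with eventually_at_right_less[of 0]
    show "\<forall>\<^sub>F d in at_right 0. log_partition 1 \<le> (\<integral>x. f x \<partial>\<mu>) + d * B\<^sup>2"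
    proof eventually_elim
      case (elim d)
      then show ?case
        using order_trans[OF log_partition_one_le[of d] log_partition_small[of d]] B_pos
        by (simp add: pos_less_divide_eq)
    qed
  qed simp
  then have "exp (log_partition 1) \<le> exp (\<integral>x. f x \<partial>\<mu>)" by simp
  then show ?thesis unfolding exp_log_partition[OF zero_less_one] by (simp add: scaled_conv_def)
qed

end

section \<open>Gaussian tails and finite second moments\<close>

lemma gaussian_tail:
  assumes R: "1 / 2 \<le> prob {x. dist x0 x \<le> R}" and m: "0 < m"
  shows "prob {x. R + sqrt (C * m) \<le> dist x0 x} \<le> exp (- m / 2)"
proof -
  \<comment> \<open>On the tail set the infimal convolution of this test function is at least
    \<open>m\<close>: a competitor outside the ball pays \<open>m\<close> through \<open>f\<close>,
    and one inside is at distance at least \<open>sqrt (C * m)\<close>. The ball carries at least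
    half of the mass, so \<open>f\<close> has integral at most \<open>m / 2\<close>, and the dual
    inequality with Markov gives the factor \<open>exp (m / 2) / exp m\<close>.\<close>
  define f where "f y = (if dist x0 y \<le> R then 0 else m)" for y
  have f [measurable]: "f \<in> borel_measurable borel" unfolding f_def by measurable
  have f_le: "\<bar>f y\<bar> \<le> m" for y using m by (simp add: f_def)
  let ?T = "{x. R + sqrt (C * m) \<le> dist x0 x}"
  have T [measurable]: "?T \<in> sets borel" by measurable
  have [measurable]: "{x. dist x0 x \<le> R} \<in> sets borel" by measurable
  have Qf [measurable]: "quad_inf_conv C f \<in> borel_measurable borel"
    by (rule borel_measurable_quad_inf_conv[OF C_pos f_le])
  have Qf_le: "\<bar>quad_inf_conv C f x\<bar> \<le> m" for x
    by (rule abs_quad_inf_conv_le[OF C_pos f_le])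
  have "m \<le> quad_inf_conv C f x" if "x \<in> ?T" for x
  proof (rule quad_inf_conv_geI[OF C_pos f_le])
    fix y
    show "m \<le> f y + (dist x y)\<^sup>2 / C"
    proof (cases "dist x0 y \<le> R")
      case True
      then have "sqrt (C * m) \<le> dist x y"
        using that dist_triangle[of x0 x y] by (simp add: dist_commute)
      then have "(sqrt (C * m))\<^sup>2 \<le> (dist x y)\<^sup>2"
        using C_pos m by (intro power_mono) auto
      then show ?thesis using True C_pos m by (simp add: f_def field_simps)
    qed (use C_pos in \<open>simp add: f_def\<close>)
  qed
  then have le: "exp m * indicator ?T x \<le> exp (quad_inf_conv C f x)" for x
    by (auto simp: indicator_def)
  have "exp m * prob ?T = (\<integral>x. exp m * indicator ?T x \<partial>\<mu>)" by simp
  also have "\<dots> \<le> (\<integral>x. exp (quad_inf_conv C f x) \<partial>\<mu>)"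
  proof (intro integral_mono le)
    show "integrable \<mu> (\<lambda>x. exp (quad_inf_conv C f x))"
      using Qf_le by (intro integrable_const_bound[where B="exp m"]) (auto simp: abs_le_iff)
    show "integrable \<mu> (\<lambda>x. exp m * indicator ?T x :: real)"
      by (intro integrable_mult_right) (simp add: less_top[symmetric])
  qed
  also have "\<dots> \<le> exp (\<integral>x. f x \<partial>\<mu>)" by (rule dual_inequality[OF f f_le m])
  also have "(\<integral>x. f x \<partial>\<mu>) = (\<integral>x. m - m * indicator {x. dist x0 x \<le> R} x \<partial>\<mu>)"
    by (intro Bochner_Integration.integral_cong) (auto simp: f_def)
  also have "\<dots> = m - m * prob {x. dist x0 x \<le> R}"
    by (subst Bochner_Integration.integral_diff) (auto simp: prob_space less_top[symmetric])
  also have "exp (m - m * prob {x. dist x0 x \<le> R}) \<le> exp (m - m * (1 / 2))"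
    using R m by (simp add: mult_left_mono)
  finally have "prob ?T \<le> exp (m - m * (1 / 2)) / exp m" by (simp add: field_simps)
  then show ?thesis by (simp flip: exp_diff)
qed

text \<open>With \<open>W\<close> the squared excess distance over \<open>C\<close>, the tail at
  level n decays like exp (- n / 2) while exp (W / 4) grows like exp (n / 4). Slicing by the integer
  part of \<open>W\<close> leaves a geometric series with ratio exp (- 1 / 4). \<open>R\<close> is
  the radius of a ball around \<open>x0\<close> with more than half of the mass.\<close>

lemma exp_square_integrable:
  obtains R where "0 \<le> R" and
    "(\<integral>\<^sup>+ x. ennreal (exp ((max 0 (dist x0 x - R))\<^sup>2 / (4 * C))) \<partial>\<mu>) < \<infinity>"
proof -
  have "(\<lambda>n. prob {x. dist x0 x \<le> real n}) \<longlonglongrightarrow> prob (\<Union>n. {x. dist x0 x \<le> real n})"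
    by (intro finite_Lim_measure_incseq) (auto simp: incseq_def)
  moreover have "(\<Union>n. {x. dist x0 x \<le> real n}) = UNIV"
    using real_arch_simple by auto
  moreover have "prob UNIV = 1" using prob_space sets_eq by (metis sets_eq_imp_space_eq space_borel)
  ultimately have "(\<lambda>n. prob {x. dist x0 x \<le> real n}) \<longlonglongrightarrow> 1" by simp
  then have "\<forall>\<^sub>F n in sequentially. prob {x. dist x0 x \<le> real n} > 1 / 2"
    by (rule order_tendstoD) simp
  then obtain N where N: "prob {x. dist x0 x \<le> real N} > 1 / 2"
    by (auto simp: eventually_sequentially)
  define R where "R = real N"
  define W where "W x = (max 0 (dist x0 x - R))\<^sup>2 / C" for x
  have W [measurable]: "W \<in> borel_measurable borel" unfolding W_def by measurable
  have W_nonneg: "W x \<ge> 0" for x using C_pos by (simp add: W_def)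
  have tail: "prob {x. real n \<le> W x} \<le> exp (- real n / 2)" for n
  proof (cases "n = 0")
    case False
    have "{x. real n \<le> W x} \<subseteq> {x. R + sqrt (C * real n) \<le> dist x0 x}"
    proof safe
      fix x assume "real n \<le> W x"
      then have *: "C * real n \<le> (max 0 (dist x0 x - R))\<^sup>2" using C_pos by (simp add: W_def field_simps)
      then have "sqrt (C * real n) \<le> max 0 (dist x0 x - R)" by (intro real_le_lsqrt) auto
      moreover have "sqrt (C * real n) > 0" using False C_pos by simp
      ultimately show "R + sqrt (C * real n) \<le> dist x0 x" by linarith
    qed
    then have "prob {x. real n \<le> W x} \<le> prob {x. R + sqrt (C * real n) \<le> dist x0 x}"
      by (intro finite_measure_mono) (auto simp: sets_eq)
    also have "\<dots> \<le> exp (- real n / 2)"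
      using N False by (intro gaussian_tail) (auto simp: R_def)
    finally show ?thesis .
  qed simp
  define r :: real where "r = exp (- 1 / 4)"
  have r: "0 < r" "r < 1" by (auto simp: r_def)
  have "(\<integral>\<^sup>+ x. ennreal (exp (W x / 4)) \<partial>\<mu>)
      \<le> (\<integral>\<^sup>+ x. (\<Sum>n. ennreal (exp ((real n + 1) / 4)) * indicator {x. real n \<le> W x} x) \<partial>\<mu>)"
  proof (intro nn_integral_mono)
    fix x
    define n where "n = nat \<lfloor>W x\<rfloor>"
    have n: "real n \<le> W x" "W x \<le> real n + 1" using W_nonneg[of x] by (auto simp: n_def)
    have "ennreal (exp (W x / 4)) \<le> ennreal (exp ((real n + 1) / 4)) * indicator {x. real n \<le> W x} x"
      using n by (simp add: ennreal_leI)
    also have "\<dots> \<le> (\<Sum>n. ennreal (exp ((real n + 1) / 4)) * indicator {x. real n \<le> W x} x)"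
    proof -
      have "g n \<le> suminf g" for g :: "nat \<Rightarrow> ennreal" using sum_le_suminf[of g "{n}"] by simp
      then show ?thesis .
    qed
    finally show "ennreal (exp (W x / 4)) \<le> \<dots>" .
  qed
  also have "\<dots> = (\<Sum>n. ennreal (exp ((real n + 1) / 4)) * emeasure \<mu> {x. real n \<le> W x})"
    by (subst nn_integral_suminf) (auto simp: nn_integral_cmult_indicator sets_eq)
  also have "\<dots> \<le> (\<Sum>n. ennreal (exp (1 / 4) * r ^ n))"
  proof (intro suminf_le)
    fix n
    have "ennreal (exp ((real n + 1) / 4)) * emeasure \<mu> {x. real n \<le> W x}
        \<le> ennreal (exp ((real n + 1) / 4)) * ennreal (exp (- real n / 2))"
      using tail[of n] by (intro mult_left_mono) (auto simp: emeasure_eq_measure)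
    also have "\<dots> = ennreal (exp (1 / 4) * r ^ n)"
      by (simp add: r_def field_simps flip: ennreal_mult exp_add exp_of_nat_mult)
    finally show "ennreal (exp ((real n + 1) / 4)) * emeasure \<mu> {x. real n \<le> W x} \<le> ennreal (exp (1 / 4) * r ^ n)" .
  qed auto
  also have "\<dots> < \<infinity>"
  proof -
    have "summable (\<lambda>n. exp (1 / 4) * r ^ n)"
      using r by (intro summable_mult summable_geometric) auto
    then show ?thesis using r by (subst suminf_ennreal2) auto
  qed
  finally show thesis by (intro that[of R]) (auto simp: W_def R_def mult.commute)
qed

text \<open>For \<open>\<mu>\<close> this follows from the exponential moment. For
  \<open>\<nu>\<close>, finite entropy transfers it through \<open>donsker_varadhan\<close>: that
  inequality takes bounded functions, so \<open>W\<close> is truncated at \<open>k\<close>, the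
  bound does not depend on \<open>k\<close>, and monotone convergence removes the
  truncation.\<close>

lemma finite_second_moment:
  assumes \<nu>: "prob_space \<nu>" and sets_\<nu>: "sets \<nu> = sets borel"
    and ac: "absolutely_continuous \<mu> \<nu>" and H: "rel_entropy \<mu> \<nu> = ereal H"
  shows "integrable \<mu> (\<lambda>x. (dist x0 x)\<^sup>2)" and "integrable \<nu> (\<lambda>x. (dist x0 x)\<^sup>2)"
proof -
  interpret \<nu>: prob_space \<nu> by (rule \<nu>)
  note [measurable_cong] = sets_\<nu>
  obtain R where R: "0 \<le> R"
    "(\<integral>\<^sup>+ x. ennreal (exp ((max 0 (dist x0 x - R))\<^sup>2 / (4 * C))) \<partial>\<mu>) < \<infinity>"
    by (rule exp_square_integrable)
  define W where "W x = (max 0 (dist x0 x - R))\<^sup>2 / (4 * C)" for x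
  have W [measurable]: "W \<in> borel_measurable borel" unfolding W_def by measurable
  have W_nonneg: "W x \<ge> 0" for x using C_pos by (simp add: W_def)
  have "integrable \<mu> (\<lambda>x. exp (W x))"
    using R(2) by (intro integrableI_nonneg) (auto simp: W_def)
  note int_exp = this
  have second_moment: "integrable M (\<lambda>x. (dist x0 x)\<^sup>2)"
    if "prob_space M" and sM: "sets M = sets borel" and int: "integrable M W" for M
  proof -
    interpret M: prob_space M by fact
    note [measurable_cong] = sM
    show ?thesis
    proof (rule Bochner_Integration.integrable_bound)
      \<comment> \<open>The factor 8 * C is 2, from (a + b)^2 <= 2 * a^2 + 2 * b^2, times the 4 * C
        in the denominator of \<open>W\<close>.\<close>
      show "integrable M (\<lambda>x. 2 * R\<^sup>2 + 8 * C * W x)" using int by simp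
      have "(dist x0 x)\<^sup>2 \<le> 2 * R\<^sup>2 + 8 * C * W x" for x
      proof -
        have "(dist x0 x)\<^sup>2 \<le> (R + max 0 (dist x0 x - R))\<^sup>2" by (intro power_mono) auto
        also have "\<dots> \<le> 2 * R\<^sup>2 + 2 * (max 0 (dist x0 x - R))\<^sup>2"
          using zero_le_power2[of "R - max 0 (dist x0 x - R)"] by (simp add: power2_sum power2_diff)
        finally show ?thesis using C_pos by (simp add: W_def)
      qed
      then show "AE x in M. norm ((dist x0 x)\<^sup>2) \<le> norm (2 * R\<^sup>2 + 8 * C * W x)"
        by (intro AE_I2) (smt (verit) real_norm_def zero_le_power2)
    qed measurable
  qed
  show "integrable \<mu> (\<lambda>x. (dist x0 x)\<^sup>2)"
  proof (rule second_moment[OF prob_space_axioms sets_eq])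
    have "W x \<le> exp (W x)" for x using exp_ge_add_one_self[of "W x"] by linarith
    then show "integrable \<mu> W"
      using W_nonneg by (intro Bochner_Integration.integrable_bound[OF int_exp]) auto
  qed
  have bound: "(\<integral>\<^sup>+ x. ennreal (min (W x) (real k)) \<partial>\<nu>) \<le> ennreal (H + ln (\<integral>x. exp (W x) \<partial>\<mu>))" for k :: nat
  proof -
    let ?w = "\<lambda>x. min (W x) (real k)"
    have w: "\<bar>?w x\<bar> \<le> real k" for x using W_nonneg[of x] by simp
    have int_w: "integrable \<mu> (\<lambda>x. exp (?w x))"
      by (intro integrable_const_bound[where B="exp (real k)"]) auto
    have "ereal ((\<integral>x. ?w x \<partial>\<nu>) - ln (\<integral>x. exp (?w x) \<partial>\<mu>)) \<le> ereal H"
      unfolding H[symmetric] using w by (intro donsker_varadhan \<nu> ac) (auto simp: sets_\<nu> sets_eq)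
    then have "(\<integral>x. ?w x \<partial>\<nu>) \<le> H + ln (\<integral>x. exp (?w x) \<partial>\<mu>)" by simp
    also have "ln (\<integral>x. exp (?w x) \<partial>\<mu>) \<le> ln (\<integral>x. exp (W x) \<partial>\<mu>)"
    proof -
      have "1 \<le> (\<integral>x. exp (?w x) \<partial>\<mu>)"
        using int_w W_nonneg by (intro integral_ge_const) auto
      moreover have "(\<integral>x. exp (?w x) \<partial>\<mu>) \<le> (\<integral>x. exp (W x) \<partial>\<mu>)"
        by (intro integral_mono int_w int_exp) simp
      ultimately show ?thesis by simp
    qed
    finally have "ennreal (\<integral>x. ?w x \<partial>\<nu>) \<le> ennreal (H + ln (\<integral>x. exp (W x) \<partial>\<mu>))" by (intro ennreal_leI) simp
    moreover have "integrable \<nu> ?w"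
      using w by (intro \<nu>.integrable_const_bound[where B="real k"]) auto
    ultimately show ?thesis using W_nonneg by (subst nn_integral_eq_integral) auto
  qed
  show "integrable \<nu> (\<lambda>x. (dist x0 x)\<^sup>2)"
  proof (rule second_moment[OF \<nu> sets_\<nu>])
    have "(\<integral>\<^sup>+ x. ennreal (W x) \<partial>\<nu>) = (\<integral>\<^sup>+ x. (SUP k. ennreal (min (W x) (real k))) \<partial>\<nu>)"
    proof (intro nn_integral_cong antisym SUP_least)
      fix x
      obtain k where "W x \<le> real k" using real_arch_simple by blast
      then show "ennreal (W x) \<le> (SUP k. ennreal (min (W x) (real k)))"
        by (intro SUP_upper2[of k]) auto
    qed (auto intro: ennreal_leI)
    also have "\<dots> = (SUP k. \<integral>\<^sup>+ x. ennreal (min (W x) (real k)) \<partial>\<nu>)"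
      by (intro nn_integral_monotone_convergence_SUP) (auto simp: incseq_def le_fun_def intro!: ennreal_leI)
    also have "\<dots> \<le> ennreal (H + ln (\<integral>x. exp (W x) \<partial>\<mu>))"
      by (intro SUP_least bound)
    also have "\<dots> < \<infinity>" by simp
    finally show "integrable \<nu> W" using W_nonneg by (intro integrableI_nonneg) auto
  qed
qed

end

section \<open>Couplings from partitions\<close>

lemma
  fixes g :: "nat \<Rightarrow> real"
  assumes M: "prob_space M" and sets_M [measurable_cong]: "sets M = sets borel"
    and idx [measurable]: "idx \<in> borel \<rightarrow>\<^sub>M count_space UNIV" and idx_le: "\<And>x. idx x \<le> n"
  shows integral_partition: "(\<integral>x. g (idx x) \<partial>M) = (\<Sum>i\<le>n. g i * measure M {x. idx x = i})"
    and nn_integral_partition: "(\<And>i. 0 \<le> g i) \<Longrightarrow>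
      (\<integral>\<^sup>+ x. ennreal (g (idx x)) \<partial>M) = ennreal (\<Sum>i\<le>n. g i * measure M {x. idx x = i})"
    and sum_measure_partition: "(\<Sum>i\<le>n. measure M {x. idx x = i}) = 1"
proof -
  interpret M: prob_space M by (rule M)
  have eq: "h (idx x) = (\<Sum>i\<le>n. h i * indicator {x. idx x = i} x)" for x and h :: "nat \<Rightarrow> real"
  proof -
    have "(\<Sum>i\<le>n. h i * indicator {x. idx x = i} x) = (\<Sum>i\<le>n. if i = idx x then h i else 0)"
      by (intro sum.cong) (auto simp: indicator_def)
    then show ?thesis using idx_le[of x] by simp
  qed
  have [simp]: "{x. idx x = i} \<in> sets M" for i unfolding sets_M by measurable
  have int: "integrable M (\<lambda>x. h (idx x))" for h :: "nat \<Rightarrow> real"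
    unfolding eq by (intro Bochner_Integration.integrable_sum integrable_mult_right) (simp add: less_top[symmetric])
  show *: "(\<integral>x. h (idx x) \<partial>M) = (\<Sum>i\<le>n. h i * measure M {x. idx x = i})" for h :: "nat \<Rightarrow> real"
    unfolding eq by (subst Bochner_Integration.integral_sum) (auto simp: less_top[symmetric])
  show "(\<integral>\<^sup>+ x. ennreal (g (idx x)) \<partial>M) = ennreal (\<Sum>i\<le>n. g i * measure M {x. idx x = i})"
    if "\<And>i. 0 \<le> g i"
    using that int[of g] by (subst nn_integral_eq_integral) (auto simp: *)
  show "(\<Sum>i\<le>n. measure M {x. idx x = i}) = 1"
    using *[of "\<lambda>_. 1"] by (simp add: M.prob_space)
qed

text \<open>The density u i j / (a i * b j) spreads the mass u i j over the product of the i-th and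
  j-th cells proportionally to the product measure; cells of mass zero give density x / 0 = 0.\<close>

lemma coupling_of_partition:
  fixes \<nu> \<mu> :: "'a::second_countable_topology measure" and idx :: "'a \<Rightarrow> nat"
  assumes \<nu>: "prob_space \<nu>" and sets_\<nu> [measurable_cong]: "sets \<nu> = sets borel"
    and \<mu>: "prob_space \<mu>" and sets_\<mu> [measurable_cong]: "sets \<mu> = sets borel"
    and idx [measurable]: "idx \<in> borel \<rightarrow>\<^sub>M count_space UNIV" and idx_le: "\<And>x. idx x \<le> n"
    and u_nonneg: "\<And>i j. i \<le> n \<Longrightarrow> j \<le> n \<Longrightarrow> 0 \<le> u i j"
    and row: "\<And>i. i \<le> n \<Longrightarrow> (\<Sum>j\<le>n. u i j) = measure \<nu> {x. idx x = i}"
    and col: "\<And>j. j \<le> n \<Longrightarrow> (\<Sum>i\<le>n. u i j) = measure \<mu> {x. idx x = j}"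
  obtains \<pi> where "\<pi> \<in> couplings \<nu> \<mu>"
    and "\<And>c. (\<And>i j. 0 \<le> c i j) \<Longrightarrow>
      (\<integral>\<^sup>+ p. ennreal (c (idx (fst p)) (idx (snd p))) \<partial>\<pi>) = ennreal (\<Sum>i\<le>n. \<Sum>j\<le>n. c i j * u i j)"
proof -
  interpret \<nu>: prob_space \<nu> by (rule \<nu>)
  interpret \<mu>: prob_space \<mu> by (rule \<mu>)
  interpret P: pair_sigma_finite \<nu> \<mu> ..
  define a where "a i = measure \<nu> {x. idx x = i}" for i
  define b where "b j = measure \<mu> {x. idx x = j}" for j
  \<comment> \<open>\<open>nn_integral_partition\<close> wants nonnegative values at all indices,
    while \<open>u\<close> is controlled only up to \<open>n\<close>.\<close>
  define u' where "u' i j = (if i \<le> n \<and> j \<le> n then u i j else 0)" for i j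
  have u'_nonneg: "0 \<le> u' i j" for i j using u_nonneg by (simp add: u'_def)
  have ab_nonneg: "0 \<le> a i" "0 \<le> b i" for i by (auto simp: a_def b_def)
  have row': "(\<Sum>j\<le>n. u' i j) = a i" if "i \<le> n" for i using row[OF that] that by (simp add: u'_def a_def)
  have col': "(\<Sum>i\<le>n. u' i j) = b j" if "j \<le> n" for j using col[OF that] that by (simp add: u'_def b_def)
  \<comment> \<open>Forced by the row and column sums. It makes division by zero harmless:
    \<open>w i j * b j = u' i j / a i\<close> also holds for null cells.\<close>
  have u0: "u' i j = 0" if "a i = 0 \<or> b j = 0" for i j
  proof (cases "i \<le> n \<and> j \<le> n")
    case True
    have "u' i j \<le> a i" using True row'[of i] member_le_sum[of j "{..n}" "u' i"] u'_nonneg by auto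
    moreover have "u' i j \<le> b j" using True col'[of j] member_le_sum[of i "{..n}" "\<lambda>i. u' i j"] u'_nonneg by auto
    ultimately show ?thesis using that u'_nonneg[of i j] by auto
  qed (auto simp: u'_def)
  define w where "w i j = u' i j / (a i * b j)" for i j
  have w_nonneg: "0 \<le> w i j" for i j using u'_nonneg ab_nonneg by (simp add: w_def)
  have w_b: "w i j * b j = u' i j / a i" and w_a: "w i j * a i = u' i j / b j" for i j
    using u0[of i j] by (auto simp: w_def)
  define \<pi> where "\<pi> = density (\<nu> \<Otimes>\<^sub>M \<mu>) (\<lambda>p. ennreal (w (idx (fst p)) (idx (snd p))))"
  have sets_P: "sets (\<nu> \<Otimes>\<^sub>M \<mu>) = sets (borel \<Otimes>\<^sub>M borel)"
    by (intro sets_pair_measure_cong sets_\<nu> sets_\<mu>)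
  have sets_\<pi> [measurable_cong]: "sets \<pi> = sets (borel \<Otimes>\<^sub>M borel)"
    by (simp add: \<pi>_def sets_P)
  have pair_meas [measurable]: "(\<lambda>p. ennreal (c (idx (fst p)) (idx (snd p)))) \<in> borel_measurable (borel \<Otimes>\<^sub>M borel)"
    for c :: "nat \<Rightarrow> nat \<Rightarrow> real"
    by measurable
  \<comment> \<open>Over a point of a null cell the density integrates to 0 instead of 1; such
    points form a null set.\<close>
  have AE_\<nu>: "AE x in \<nu>. a (idx x) \<noteq> 0"
  proof -
    have "AE x in \<nu>. \<forall>i. a i = 0 \<longrightarrow> idx x \<noteq> i"
      unfolding AE_all_countable
    proof
      fix i
      have "{x. idx x = i} \<in> sets \<nu>" by measurable
      then have "AE x in \<nu>. idx x \<noteq> i" if "a i = 0"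
        using that AE_not_in[of "{x. idx x = i}" \<nu>] by (simp add: a_def null_sets_def \<nu>.emeasure_eq_measure)
      then show "AE x in \<nu>. a i = 0 \<longrightarrow> idx x \<noteq> i" by auto
    qed
    then show ?thesis by eventually_elim auto
  qed
  have AE_\<mu>: "AE x in \<mu>. b (idx x) \<noteq> 0"
  proof -
    have "AE x in \<mu>. \<forall>i. b i = 0 \<longrightarrow> idx x \<noteq> i"
      unfolding AE_all_countable
    proof
      fix i
      have "{x. idx x = i} \<in> sets \<mu>" by measurable
      then have "AE x in \<mu>. idx x \<noteq> i" if "b i = 0"
        using that AE_not_in[of "{x. idx x = i}" \<mu>] by (simp add: b_def null_sets_def \<mu>.emeasure_eq_measure)
      then show "AE x in \<mu>. b i = 0 \<longrightarrow> idx x \<noteq> i" by auto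
    qed
    then show ?thesis by eventually_elim auto
  qed
  have inner_\<mu>: "(\<integral>\<^sup>+ y. ennreal (c (idx y) * w i (idx y)) \<partial>\<mu>) = ennreal (\<Sum>j\<le>n. c j * (u' i j / a i))"
    if "\<And>j. 0 \<le> c j" for c i
    using nn_integral_partition[OF \<mu> sets_\<mu> idx idx_le, of "\<lambda>j. c j * w i j"] that w_nonneg
    by (simp add: b_def[symmetric] mult.assoc w_b)
  have inner_\<nu>: "(\<integral>\<^sup>+ x. ennreal (w (idx x) j) \<partial>\<nu>) = ennreal (\<Sum>i\<le>n. u' i j / b j)" for j
    using nn_integral_partition[OF \<nu> sets_\<nu> idx idx_le, of "\<lambda>i. w i j"] w_nonneg
    by (simp add: a_def[symmetric] w_a)
  have int_\<pi>: "(\<integral>\<^sup>+ p. h p \<partial>\<pi>) = (\<integral>\<^sup>+ p. ennreal (w (idx (fst p)) (idx (snd p))) * h p \<partial>(\<nu> \<Otimes>\<^sub>M \<mu>))"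
    if [measurable]: "h \<in> borel_measurable (borel \<Otimes>\<^sub>M borel)" for h
    unfolding \<pi>_def by (intro nn_integral_density) measurable
  have fst_marginal: "distr \<pi> borel fst = \<nu>"
  proof (rule measure_eqI)
    fix A :: "'a set" assume "A \<in> sets (distr \<pi> borel fst)"
    then have A [measurable]: "A \<in> sets borel" by simp
    have "emeasure (distr \<pi> borel fst) A = (\<integral>\<^sup>+ p. indicator A (fst p) \<partial>\<pi>)"
      by (simp flip: nn_integral_indicator add: nn_integral_distr)
    also have "\<dots> = (\<integral>\<^sup>+ p. ennreal (w (idx (fst p)) (idx (snd p))) * indicator A (fst p) \<partial>(\<nu> \<Otimes>\<^sub>M \<mu>))"
      by (rule int_\<pi>) measurable
    also have "\<dots> = (\<integral>\<^sup>+ x. \<integral>\<^sup>+ y. ennreal (w (idx x) (idx y)) * indicator A x \<partial>\<mu> \<partial>\<nu>)"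
      by (subst \<mu>.nn_integral_fst[symmetric]) auto
    also have "\<dots> = (\<integral>\<^sup>+ x. indicator A x \<partial>\<nu>)"
    proof (rule nn_integral_cong_AE)
      show "AE x in \<nu>. (\<integral>\<^sup>+ y. ennreal (w (idx x) (idx y)) * indicator A x \<partial>\<mu>) = indicator A x"
        using AE_\<nu>
      proof eventually_elim
        case (elim x)
        have "(\<integral>\<^sup>+ y. ennreal (w (idx x) (idx y)) * indicator A x \<partial>\<mu>)
            = (\<integral>\<^sup>+ y. ennreal (w (idx x) (idx y)) \<partial>\<mu>) * indicator A x"
          by (intro nn_integral_multc) measurable
        also have "(\<integral>\<^sup>+ y. ennreal (w (idx x) (idx y)) \<partial>\<mu>) = 1"
          using inner_\<mu>[of "\<lambda>_. 1" "idx x"] row'[OF idx_le, of x] elim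
          by (simp flip: sum_divide_distrib)
        finally show ?case by simp
      qed
    qed
    also have "\<dots> = emeasure \<nu> A" by (simp add: sets_\<nu>)
    finally show "emeasure (distr \<pi> borel fst) A = emeasure \<nu> A" .
  qed (simp add: sets_\<nu>)
  have snd_marginal: "distr \<pi> borel snd = \<mu>"
  proof (rule measure_eqI)
    fix A :: "'a set" assume "A \<in> sets (distr \<pi> borel snd)"
    then have A [measurable]: "A \<in> sets borel" by simp
    have "emeasure (distr \<pi> borel snd) A = (\<integral>\<^sup>+ p. indicator A (snd p) \<partial>\<pi>)"
      by (simp flip: nn_integral_indicator add: nn_integral_distr)
    also have "\<dots> = (\<integral>\<^sup>+ p. ennreal (w (idx (fst p)) (idx (snd p))) * indicator A (snd p) \<partial>(\<nu> \<Otimes>\<^sub>M \<mu>))"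
      by (rule int_\<pi>) measurable
    also have "\<dots> = (\<integral>\<^sup>+ y. \<integral>\<^sup>+ x. ennreal (w (idx x) (idx y)) * indicator A y \<partial>\<nu> \<partial>\<mu>)"
      by (subst P.nn_integral_snd[symmetric]) auto
    also have "\<dots> = (\<integral>\<^sup>+ y. indicator A y \<partial>\<mu>)"
    proof (rule nn_integral_cong_AE)
      show "AE y in \<mu>. (\<integral>\<^sup>+ x. ennreal (w (idx x) (idx y)) * indicator A y \<partial>\<nu>) = indicator A y"
        using AE_\<mu>
      proof eventually_elim
        case (elim y)
        have "(\<integral>\<^sup>+ x. ennreal (w (idx x) (idx y)) * indicator A y \<partial>\<nu>)
            = (\<integral>\<^sup>+ x. ennreal (w (idx x) (idx y)) \<partial>\<nu>) * indicator A y"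
          by (intro nn_integral_multc) measurable
        also have "(\<integral>\<^sup>+ x. ennreal (w (idx x) (idx y)) \<partial>\<nu>) = 1"
          using inner_\<nu>[of "idx y"] col'[OF idx_le, of y] elim
          by (simp flip: sum_divide_distrib)
        finally show ?case by simp
      qed
    qed
    also have "\<dots> = emeasure \<mu> A" by (simp add: sets_\<mu>)
    finally show "emeasure (distr \<pi> borel snd) A = emeasure \<mu> A" .
  qed (simp add: sets_\<mu>)
  have "prob_space \<pi>"
    by (rule prob_space_distrD[of fst _ borel]) (simp_all add: fst_marginal \<nu>)
  then have "\<pi> \<in> couplings \<nu> \<mu>"
    by (simp add: couplings_def sets_\<pi> fst_marginal snd_marginal)
  moreover have "(\<integral>\<^sup>+ p. ennreal (c (idx (fst p)) (idx (snd p))) \<partial>\<pi>) = ennreal (\<Sum>i\<le>n. \<Sum>j\<le>n. c i j * u i j)"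
    if c: "\<And>i j. 0 \<le> c i j" for c
  proof -
    have "(\<integral>\<^sup>+ p. ennreal (c (idx (fst p)) (idx (snd p))) \<partial>\<pi>)
        = (\<integral>\<^sup>+ p. ennreal (w (idx (fst p)) (idx (snd p))) * ennreal (c (idx (fst p)) (idx (snd p))) \<partial>(\<nu> \<Otimes>\<^sub>M \<mu>))"
      by (rule int_\<pi>) measurable
    also have "\<dots> = (\<integral>\<^sup>+ x. \<integral>\<^sup>+ y. ennreal (w (idx x) (idx y)) * ennreal (c (idx x) (idx y)) \<partial>\<mu> \<partial>\<nu>)"
      by (subst \<mu>.nn_integral_fst[symmetric]) auto
    also have "\<dots> = (\<integral>\<^sup>+ x. ennreal (\<Sum>j\<le>n. c (idx x) j * (u' (idx x) j / a (idx x))) \<partial>\<nu>)"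
      using inner_\<mu> c by (intro nn_integral_cong) (simp add: w_nonneg mult.commute flip: ennreal_mult)
    also have "\<dots> = ennreal (\<Sum>i\<le>n. (\<Sum>j\<le>n. c i j * (u' i j / a i)) * a i)"
      using u'_nonneg ab_nonneg c unfolding a_def
      by (intro nn_integral_partition[OF \<nu> sets_\<nu> idx idx_le] sum_nonneg) simp
    also have "(\<Sum>i\<le>n. (\<Sum>j\<le>n. c i j * (u' i j / a i)) * a i) = (\<Sum>i\<le>n. \<Sum>j\<le>n. c i j * u i j)"
      unfolding sum_distrib_right
    proof (intro sum.cong refl)
      fix i j assume "i \<in> {..n}" "j \<in> {..n}"
      then show "c i j * (u' i j / a i) * a i = c i j * u i j"
        using u0[of i j] by (cases "a i = 0") (auto simp: u'_def)
    qed
    finally show ?thesis .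
  qed
  ultimately show thesis by (rule that)
qed

section \<open>Discretised transport cost and passage to the limit\<close>

context restricted_log_sobolev
begin

text \<open>For the step function \<open>f\<close> equal to \<open>- \<psi> (idx y)\<close>, the
  constraint and \<open>c_le\<close> give \<open>\<phi> (idx x) \<le> quad_inf_conv C f x\<close>.
  Integrating against \<open>\<nu>\<close>, \<open>donsker_varadhan\<close> brings in
  \<open>H\<close> and the dual inequality replaces the logarithm by the integral of
  \<open>f\<close>.\<close>

lemma step_dual_inequality:
  fixes idx :: "'a \<Rightarrow> nat"
  assumes \<nu>: "prob_space \<nu>" and sets_\<nu>: "sets \<nu> = sets borel"
    and ac: "absolutely_continuous \<mu> \<nu>" and H: "rel_entropy \<mu> \<nu> = ereal H"
    and idx [measurable]: "idx \<in> borel \<rightarrow>\<^sub>M count_space UNIV" and idx_le: "\<And>x. idx x \<le> n"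
    and c_le: "\<And>x y. c (idx x) (idx y) \<le> (dist x y)\<^sup>2 / C"
    and \<phi>\<psi>: "\<And>i j. i \<le> n \<Longrightarrow> j \<le> n \<Longrightarrow> \<phi> i + \<psi> j \<le> c i j"
  shows "(\<Sum>i\<le>n. \<phi> i * measure \<nu> {x. idx x = i}) + (\<Sum>j\<le>n. \<psi> j * measure \<mu> {x. idx x = j}) \<le> H"
proof -
  interpret \<nu>: prob_space \<nu> by (rule \<nu>)
  note [measurable_cong] = sets_\<nu>
  define f where "f y = - \<psi> (idx y)" for y
  \<comment> \<open>The summand 1 makes \<open>B\<close> positive even if every
    \<open>\<psi> j\<close> vanishes, as \<open>dual_inequality\<close> demands.\<close>
  define B where "B = (\<Sum>j\<le>n. \<bar>\<psi> j\<bar>) + 1"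
  have B: "B > 0" unfolding B_def by (intro add_nonneg_pos sum_nonneg) auto
  have f [measurable]: "f \<in> borel_measurable borel" unfolding f_def by measurable
  have f_le: "\<bar>f y\<bar> \<le> B" for y
    using member_le_sum[of "idx y" "{..n}" "\<lambda>j. \<bar>\<psi> j\<bar>"] idx_le[of y] by (simp add: f_def B_def)
  let ?Q = "quad_inf_conv C f"
  have Q [measurable]: "?Q \<in> borel_measurable borel"
    by (rule borel_measurable_quad_inf_conv[OF C_pos f_le])
  have Q_le: "\<bar>?Q x\<bar> \<le> B" for x by (rule abs_quad_inf_conv_le[OF C_pos f_le])
  have \<phi>_Q: "\<phi> (idx x) \<le> ?Q x" for x
  proof (rule quad_inf_conv_geI[OF C_pos f_le])
    fix y show "\<phi> (idx x) \<le> f y + (dist x y)\<^sup>2 / C"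
      using \<phi>\<psi>[OF idx_le idx_le, of x y] c_le[of x y] by (simp add: f_def)
  qed
  have "(\<Sum>i\<le>n. \<phi> i * measure \<nu> {x. idx x = i}) = (\<integral>x. \<phi> (idx x) \<partial>\<nu>)"
    by (rule integral_partition[OF \<nu> sets_\<nu> idx idx_le, symmetric])
  also have "\<dots> \<le> (\<integral>x. ?Q x \<partial>\<nu>)"
  proof (intro integral_mono \<phi>_Q)
    show "integrable \<nu> ?Q" using Q_le by (intro \<nu>.integrable_const_bound[where B=B]) auto
    have "\<bar>\<phi> (idx x)\<bar> \<le> (\<Sum>i\<le>n. \<bar>\<phi> i\<bar>)" for x
      using member_le_sum[of "idx x" "{..n}" "\<lambda>j. \<bar>\<phi> j\<bar>"] idx_le[of x] by simp
    then show "integrable \<nu> (\<lambda>x. \<phi> (idx x))"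
      by (intro \<nu>.integrable_const_bound[where B="\<Sum>i\<le>n. \<bar>\<phi> i\<bar>"]) auto
  qed
  also have "\<dots> \<le> H + ln (\<integral>x. exp (?Q x) \<partial>\<mu>)"
  proof -
    have "ereal ((\<integral>x. ?Q x \<partial>\<nu>) - ln (\<integral>x. exp (?Q x) \<partial>\<mu>)) \<le> ereal H"
      unfolding H[symmetric] using Q_le by (intro donsker_varadhan \<nu> ac) (auto simp: sets_\<nu> sets_eq)
    then show ?thesis by simp
  qed
  also have "ln (\<integral>x. exp (?Q x) \<partial>\<mu>) \<le> (\<integral>x. f x \<partial>\<mu>)"
  proof -
    have "0 < (\<integral>x. exp (?Q x) \<partial>\<mu>)" using Q_le by (intro expectation_exp_pos) auto
    then show ?thesis using dual_inequality[OF f f_le B] by (metis exp_gt_zero ln_exp ln_le_cancel_iff)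
  qed
  also have "(\<integral>x. f x \<partial>\<mu>) = - (\<Sum>j\<le>n. \<psi> j * measure \<mu> {x. idx x = j})"
    using integral_partition[OF prob_space_axioms sets_eq idx idx_le, of "\<lambda>j. - \<psi> j"]
    by (simp add: f_def sum_negf)
  finally show ?thesis by simp
qed

text \<open>Cell \<open>k < n\<close> is the part of the \<open>\<epsilon>\<close>-ball around
  \<open>z k\<close> outside the earlier balls, and cell \<open>n\<close> is what remains. The first
  two terms bound the cost between small cells; the others pay for pairs touching cell
  \<open>n\<close>, whose cost is bounded by second moments cut at level \<open>R\<close>.\<close>

lemma W2_sq_le_discretised:
  fixes z :: "nat \<Rightarrow> 'a"
  assumes \<nu>: "prob_space \<nu>" and sets_\<nu>: "sets \<nu> = sets borel"
    and ac: "absolutely_continuous \<mu> \<nu>" and H: "rel_entropy \<mu> \<nu> = ereal H"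
    and \<theta>: "\<theta> > 0" and \<epsilon>: "\<epsilon> > 0" and R: "R \<ge> 0"
  shows "W2_sq \<nu> \<mu> \<le> ennreal ((1 + \<theta>) * (C * H) + (1 + 1 / \<theta>) * (16 * \<epsilon>\<^sup>2)
     + 4 * R * (measure \<nu> {x. \<forall>k<n. \<epsilon> \<le> dist x (z k)} + measure \<mu> {x. \<forall>k<n. \<epsilon> \<le> dist x (z k)})
     + 2 * ((\<integral>x. max 0 ((dist x0 x)\<^sup>2 - R) \<partial>\<nu>) + (\<integral>x. max 0 ((dist x0 x)\<^sup>2 - R) \<partial>\<mu>)))"
proof -
  interpret \<nu>: prob_space \<nu> by (rule \<nu>)
  note [measurable_cong] = sets_\<nu>
  define idx where "idx x = (LEAST k. k = n \<or> dist x (z k) < \<epsilon>)" for x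
  have idx [measurable]: "idx \<in> borel \<rightarrow>\<^sub>M count_space UNIV"
    unfolding idx_def by measurable
  have idx_le: "idx x \<le> n" for x unfolding idx_def by (rule Least_le) simp
  have idx_near: "dist x (z (idx x)) < \<epsilon>" if "idx x < n" for x
    using LeastI[of "\<lambda>k. k = n \<or> dist x (z k) < \<epsilon>" n] that unfolding idx_def by auto
  have idx_n: "{x. idx x = n} = {x. \<forall>k<n. \<epsilon> \<le> dist x (z k)}"
  proof (intro Collect_cong iffI allI impI)
    fix x k assume "idx x = n" "k < n"
    then show "\<epsilon> \<le> dist x (z k)"
      using not_less_Least[of k "\<lambda>k. k = n \<or> dist x (z k) < \<epsilon>"] by (auto simp: idx_def)
  next
    fix x assume "\<forall>k<n. \<epsilon> \<le> dist x (z k)"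
    then show "idx x = n" using idx_near[of x] idx_le[of x] by (meson le_neq_implies_less not_less)
  qed
  define m where "m i j = max 0 (dist (z i) (z j) - 2 * \<epsilon>)" for i j
  \<comment> \<open>The discrete cost must stay below the true one for the dual inequality: the
    distance of the centres loses \<open>2 * \<epsilon>\<close>, and pairs touching the remaining
    cell get cost 0.\<close>
  define c where "c i j = (if i < n \<and> j < n then (m i j)\<^sup>2 / C else 0)" for i j
  have c_nonneg: "0 \<le> c i j" for i j using C_pos by (simp add: c_def)
  have c_le: "c (idx x) (idx y) \<le> (dist x y)\<^sup>2 / C" for x y
  proof (cases "idx x < n \<and> idx y < n")
    case True
    have "dist (z (idx x)) (z (idx y)) \<le> dist x (z (idx x)) + dist x y + dist y (z (idx y))"
      by metric
    then have "m (idx x) (idx y) \<le> dist x y" using True idx_near[of x] idx_near[of y] by (simp add: m_def)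
    then have "(m (idx x) (idx y))\<^sup>2 \<le> (dist x y)\<^sup>2" by (intro power_mono) (auto simp: m_def)
    then show ?thesis using True C_pos by (simp add: c_def divide_right_mono)
  qed (use C_pos in \<open>auto simp: c_def\<close>)
  obtain u where u: "\<And>i j. i \<in> {..n} \<Longrightarrow> j \<in> {..n} \<Longrightarrow> 0 \<le> u i j"
    "\<And>i. i \<in> {..n} \<Longrightarrow> (\<Sum>j\<le>n. u i j) = measure \<nu> {x. idx x = i}"
    "\<And>j. j \<in> {..n} \<Longrightarrow> (\<Sum>i\<le>n. u i j) = measure \<mu> {x. idx x = j}"
    "(\<Sum>i\<le>n. \<Sum>j\<le>n. c i j * u i j) \<le> H"
  proof (rule finite_kantorovich_duality[of "{..n}" "{..n}" "\<lambda>i. measure \<nu> {x. idx x = i}"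
        "\<lambda>j. measure \<mu> {x. idx x = j}" c H])
    show "sum (\<lambda>i. measure \<nu> {x. idx x = i}) {..n} = 1"
      by (rule sum_measure_partition[OF \<nu> sets_\<nu> idx idx_le])
    show "sum (\<lambda>i. measure \<mu> {x. idx x = i}) {..n} = 1"
      by (rule sum_measure_partition[OF prob_space_axioms sets_eq idx idx_le])
    show "(\<Sum>i\<le>n. \<phi> i * measure \<nu> {x. idx x = i}) + (\<Sum>j\<le>n. \<psi> j * measure \<mu> {x. idx x = j}) \<le> H"
      if "\<And>i j. i \<in> {..n} \<Longrightarrow> j \<in> {..n} \<Longrightarrow> \<phi> i + \<psi> j \<le> c i j" for \<phi> \<psi>
      using that by (intro step_dual_inequality[OF \<nu> sets_\<nu> ac H idx idx_le c_le]) auto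
  qed auto
  have H_nonneg: "H \<ge> 0"
    using u(1,4) c_nonneg by (intro order_trans[OF _ u(4)] sum_nonneg mult_nonneg_nonneg) auto
  obtain \<pi> where \<pi>: "\<pi> \<in> couplings \<nu> \<mu>" and \<pi>_cost: "\<And>c. (\<And>i j. 0 \<le> c i j) \<Longrightarrow>
      (\<integral>\<^sup>+ p. ennreal (c (idx (fst p)) (idx (snd p))) \<partial>\<pi>) = ennreal (\<Sum>i\<le>n. \<Sum>j\<le>n. c i j * u i j)"
    by (rule coupling_of_partition[OF \<nu> sets_\<nu> prob_space_axioms sets_eq idx idx_le, of u]) (use u in auto)
  from \<pi> have \<pi>_prob: "prob_space \<pi>" and sets_\<pi> [measurable_cong]: "sets \<pi> = sets (borel \<Otimes>\<^sub>M borel)"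
    and \<pi>_fst: "distr \<pi> borel fst = \<nu>" and \<pi>_snd: "distr \<pi> borel snd = \<mu>"
    by (auto simp: couplings_def)
  interpret \<pi>: prob_space \<pi> by (rule \<pi>_prob)
  define h where "h x = (dist x0 x)\<^sup>2" for x
  \<comment> \<open>The indicator has weight \<open>2 * R\<close> rather than \<open>R\<close>
    because, when only one point lies in cell \<open>n\<close>, it must pay the level
    \<open>R\<close> for both.\<close>
  define t where "t x = 2 * R * indicator {x. idx x = n} x + max 0 (h x - R)" for x
  have h [measurable]: "h \<in> borel_measurable borel" unfolding h_def by measurable
  have t [measurable]: "t \<in> borel_measurable borel" unfolding t_def by measurable
  have t_nonneg: "0 \<le> t x" for x using R by (simp add: t_def)
  have pointwise: "(dist x y)\<^sup>2 \<le> (1 + \<theta>) * C * c (idx x) (idx y) + (1 + 1 / \<theta>) * (16 * \<epsilon>\<^sup>2) + 2 * t x + 2 * t y"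
    for x y
  proof (cases "idx x < n \<and> idx y < n")
    case True
    let ?m = "m (idx x) (idx y)"
    have "dist x y \<le> dist x (z (idx x)) + dist (z (idx x)) (z (idx y)) + dist y (z (idx y))"
      by metric
    \<comment> \<open>One \<open>2 * \<epsilon>\<close> is the distance to the two centres, the
      other undoes the subtraction in \<open>m\<close>.\<close>
    then have "dist x y \<le> ?m + 4 * \<epsilon>"
      using True idx_near[of x] idx_near[of y] by (simp add: m_def)
    then have "(dist x y)\<^sup>2 \<le> (?m + 4 * \<epsilon>)\<^sup>2" by (intro power_mono) auto
    also have "\<dots> \<le> (1 + \<theta>) * ?m\<^sup>2 + (1 + 1 / \<theta>) * (16 * \<epsilon>\<^sup>2)"
    proof -
      \<comment> \<open>Weighted Young inequality for the cross term
        \<open>8 * ?m * \<epsilon>\<close>; a small \<open>\<theta>\<close> keeps the factor of the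
        main term close to 1.\<close>
      have "0 \<le> (\<theta> * ?m - 4 * \<epsilon>)\<^sup>2 / \<theta>" using \<theta> by simp
      also have "\<dots> = \<theta> * ?m\<^sup>2 - 8 * ?m * \<epsilon> + 16 * \<epsilon>\<^sup>2 / \<theta>"
        using \<theta> by (simp add: power2_eq_square field_simps)
      finally show ?thesis by (simp add: power2_eq_square algebra_simps)
    qed
    also have "(1 + \<theta>) * ?m\<^sup>2 = (1 + \<theta>) * C * c (idx x) (idx y)"
      using True C_pos by (simp add: c_def)
    finally show ?thesis using t_nonneg[of x] t_nonneg[of y] by simp
  next
    case False
    then have "idx x = n \<or> idx y = n" using idx_le[of x] idx_le[of y] by auto
    then have R_le: "2 * R \<le> 2 * R * indicator {x. idx x = n} x + 2 * R * indicator {x. idx x = n} y"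
      using R by (auto simp: indicator_def)
    have "(dist x y)\<^sup>2 \<le> (dist x0 x + dist x0 y)\<^sup>2"
      by (intro power_mono) (metric, simp)
    also have "\<dots> \<le> 2 * h x + 2 * h y"
      using zero_le_power2[of "dist x0 x - dist x0 y"] by (simp add: h_def power2_sum power2_diff)
    also have "\<dots> \<le> 2 * t x + 2 * t y" using R_le by (simp add: t_def max_def)
    also have "\<dots> \<le> (1 + \<theta>) * C * c (idx x) (idx y) + (1 + 1 / \<theta>) * (16 * \<epsilon>\<^sup>2) + 2 * t x + 2 * t y"
      using \<theta> C_pos c_nonneg by simp
    finally show ?thesis .
  qed
  have second_moment: "integrable \<nu> h" "integrable \<mu> h"
    unfolding h_def by (rule finite_second_moment[OF \<nu> sets_\<nu> ac H])+
  have t_int: "(\<integral>\<^sup>+ x. ennreal (2 * t x) \<partial>M) = ennreal (4 * R * measure M {x. \<forall>k<n. \<epsilon> \<le> dist x (z k)} + 2 * (\<integral>x. max 0 (h x - R) \<partial>M))"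
    if "prob_space M" and sM: "sets M = sets borel" and int: "integrable M h" for M
  proof -
    interpret M: prob_space M by fact
    note [measurable_cong] = sM
    have [simp]: "{x. idx x = n} \<in> sets M" unfolding sM by measurable
    have 1: "integrable M (\<lambda>x. max 0 (h x - R))"
      using int by (intro integrable_max) auto
    have 2: "integrable M (\<lambda>x. 2 * R * indicator {x. idx x = n} x :: real)"
      by (intro integrable_mult_right) (simp add: less_top[symmetric])
    have "integrable M (\<lambda>x. 2 * t x)" unfolding t_def using 1 2 by simp
    then have "(\<integral>\<^sup>+ x. ennreal (2 * t x) \<partial>M) = ennreal (\<integral>x. 2 * t x \<partial>M)"
      using t_nonneg by (intro nn_integral_eq_integral) auto
    also have "(\<integral>x. 2 * t x \<partial>M) = 2 * ((\<integral>x. 2 * R * indicator {x. idx x = n} x \<partial>M) + (\<integral>x. max 0 (h x - R) \<partial>M))"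
      unfolding t_def using 1 2 by simp
    also have "\<dots> = 4 * R * measure M {x. \<forall>k<n. \<epsilon> \<le> dist x (z k)} + 2 * (\<integral>x. max 0 (h x - R) \<partial>M)"
      by (simp flip: idx_n)
    finally show ?thesis .
  qed
  have "W2_sq \<nu> \<mu> \<le> (\<integral>\<^sup>+ p. ennreal ((dist (fst p) (snd p))\<^sup>2) \<partial>\<pi>)"
    unfolding W2_sq_def by (rule INF_lower[OF \<pi>])
  also have "\<dots> \<le> (\<integral>\<^sup>+ p. (ennreal ((1 + \<theta>) * C * c (idx (fst p)) (idx (snd p))) + ennreal ((1 + 1 / \<theta>) * (16 * \<epsilon>\<^sup>2)))
      + ennreal (2 * t (fst p)) + ennreal (2 * t (snd p)) \<partial>\<pi>)"
    using pointwise \<theta> C_pos c_nonneg t_nonneg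
    by (intro nn_integral_mono) (simp flip: ennreal_plus add: ennreal_leI)
  also have "\<dots> = (\<integral>\<^sup>+ p. ennreal ((1 + \<theta>) * C * c (idx (fst p)) (idx (snd p))) \<partial>\<pi>) + ennreal ((1 + 1 / \<theta>) * (16 * \<epsilon>\<^sup>2))
      + (\<integral>\<^sup>+ p. ennreal (2 * t (fst p)) \<partial>\<pi>) + (\<integral>\<^sup>+ p. ennreal (2 * t (snd p)) \<partial>\<pi>)"
    by (simp add: nn_integral_add \<pi>.emeasure_space_1)
  also have "(\<integral>\<^sup>+ p. ennreal ((1 + \<theta>) * C * c (idx (fst p)) (idx (snd p))) \<partial>\<pi>) \<le> ennreal ((1 + \<theta>) * (C * H))"
  proof -
    have "(\<integral>\<^sup>+ p. ennreal ((1 + \<theta>) * C * c (idx (fst p)) (idx (snd p))) \<partial>\<pi>)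
        = ennreal (\<Sum>i\<le>n. \<Sum>j\<le>n. (1 + \<theta>) * C * c i j * u i j)"
      using \<theta> C_pos c_nonneg by (intro \<pi>_cost[of "\<lambda>i j. (1 + \<theta>) * C * c i j"]) simp
    also have "(\<Sum>i\<le>n. \<Sum>j\<le>n. (1 + \<theta>) * C * c i j * u i j) = (1 + \<theta>) * C * (\<Sum>i\<le>n. \<Sum>j\<le>n. c i j * u i j)"
      by (simp add: sum_distrib_left mult.assoc)
    also have "\<dots> \<le> (1 + \<theta>) * C * H" using \<theta> C_pos u(4) by (intro mult_left_mono) auto
    finally show ?thesis by (simp add: mult.assoc ennreal_leI)
  qed
  also have "(\<integral>\<^sup>+ p. ennreal (2 * t (fst p)) \<partial>\<pi>) = (\<integral>\<^sup>+ x. ennreal (2 * t x) \<partial>\<nu>)"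
    unfolding \<pi>_fst[symmetric] by (subst nn_integral_distr) auto
  also have "(\<integral>\<^sup>+ p. ennreal (2 * t (snd p)) \<partial>\<pi>) = (\<integral>\<^sup>+ x. ennreal (2 * t x) \<partial>\<mu>)"
    unfolding \<pi>_snd[symmetric] by (subst nn_integral_distr) auto
  finally have "W2_sq \<nu> \<mu> \<le> ennreal ((1 + \<theta>) * (C * H)) + ennreal ((1 + 1 / \<theta>) * (16 * \<epsilon>\<^sup>2))
      + (\<integral>\<^sup>+ x. ennreal (2 * t x) \<partial>\<nu>) + (\<integral>\<^sup>+ x. ennreal (2 * t x) \<partial>\<mu>)"
    by (simp add: add_mono)
  also have "\<dots> = ennreal ((1 + \<theta>) * (C * H) + (1 + 1 / \<theta>) * (16 * \<epsilon>\<^sup>2)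
     + (4 * R * measure \<nu> {x. \<forall>k<n. \<epsilon> \<le> dist x (z k)} + 2 * (\<integral>x. max 0 (h x - R) \<partial>\<nu>))
     + (4 * R * measure \<mu> {x. \<forall>k<n. \<epsilon> \<le> dist x (z k)} + 2 * (\<integral>x. max 0 (h x - R) \<partial>\<mu>)))"
    unfolding t_int[OF \<nu> sets_\<nu> second_moment(1)] t_int[OF prob_space_axioms sets_eq second_moment(2)]
    using \<theta> R C_pos H_nonneg by (simp flip: ennreal_plus)
  finally show ?thesis by (simp add: h_def algebra_simps)
qed

text \<open>The order of the limits matters. First \<open>n\<close> grows, since the leftover mass
  is multiplied by the cut-off level; then the level grows, using finite second moments; then
  \<open>\<epsilon>\<close> tends to 0 before \<open>\<theta>\<close>, since
  \<open>1 / \<theta>\<close> multiplies its square.\<close>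

lemma W2_sq_le_rel_entropy:
  assumes \<nu>: "prob_space \<nu>" and sets_\<nu>: "sets \<nu> = sets borel"
    and ac: "absolutely_continuous \<mu> \<nu>" and H: "rel_entropy \<mu> \<nu> = ereal H" and H_nonneg: "0 \<le> H"
  shows "W2_sq \<nu> \<mu> \<le> ennreal (C * H)"
proof -
  interpret \<nu>: prob_space \<nu> by (rule \<nu>)
  obtain S :: "'a set" where S: "countable S" "\<And>X. open X \<Longrightarrow> X \<noteq> {} \<Longrightarrow> \<exists>d\<in>S. d \<in> X"
    using countable_dense_exists by blast
  define z where "z = from_nat_into S"
  have "S \<noteq> {}" using S(2)[of UNIV] by auto
  then have z: "\<exists>k. dist x (z k) < \<epsilon>" if \<epsilon>: "\<epsilon> > 0" for x \<epsilon>
  proof -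
    obtain d where "d \<in> S" "d \<in> ball x \<epsilon>" using S(2)[of "ball x \<epsilon>"] \<epsilon> by auto
    then show ?thesis using from_nat_into_surj[OF S(1), of d] by (auto simp: z_def)
  qed
  have rest: "(\<lambda>n. measure M {x. \<forall>k<n. \<epsilon> \<le> dist x (z k)}) \<longlonglongrightarrow> 0"
    if "prob_space M" and sM: "sets M = sets borel" and \<epsilon>: "\<epsilon> > 0" for M \<epsilon>
  proof -
    interpret M: prob_space M by fact
    have "(\<lambda>n. measure M {x. \<forall>k<n. \<epsilon> \<le> dist x (z k)}) \<longlonglongrightarrow> measure M (\<Inter>n. {x. \<forall>k<n. \<epsilon> \<le> dist x (z k)})"
      by (intro M.finite_Lim_measure_decseq) (auto simp: decseq_def sM)
    moreover have "(\<Inter>n. {x. \<forall>k<n. \<epsilon> \<le> dist x (z k)}) = {}"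
    proof -
      have "x \<notin> (\<Inter>n. {x. \<forall>k<n. \<epsilon> \<le> dist x (z k)})" for x
      proof -
        obtain k where "dist x (z k) < \<epsilon>" using z[OF \<epsilon>] by blast
        then have "x \<notin> {x. \<forall>i<Suc k. \<epsilon> \<le> dist x (z i)}" by (auto simp: not_le)
        then show ?thesis by blast
      qed
      then show ?thesis by blast
    qed
    ultimately show ?thesis by simp
  qed
  define x0 where "x0 = z 0"
  define E where "E M R = (\<integral>x. max 0 ((dist x0 x)\<^sup>2 - R) \<partial>M)" for M :: "'a measure" and R
  have E_lim: "(\<lambda>k. E M (real k)) \<longlonglongrightarrow> 0"
    if "sets M = sets borel" and int: "integrable M (\<lambda>x. (dist x0 x)\<^sup>2)" for M
  proof -
    note [measurable_cong] = that(1)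
    have "(\<lambda>k. \<integral>x. max 0 ((dist x0 x)\<^sup>2 - real k) \<partial>M) \<longlonglongrightarrow> (\<integral>x. 0 \<partial>M)"
    proof (rule integral_dominated_convergence[OF _ _ int])
      show "AE x in M. (\<lambda>k. max 0 ((dist x0 x)\<^sup>2 - real k)) \<longlonglongrightarrow> 0"
      proof (rule AE_I2)
        fix x
        obtain K where K: "(dist x0 x)\<^sup>2 \<le> real K" using real_arch_simple by blast
        have "\<forall>\<^sub>F k in sequentially. max 0 ((dist x0 x)\<^sup>2 - real k) = 0"
          using eventually_ge_at_top[of K] by eventually_elim (use K in auto)
        then show "(\<lambda>k. max 0 ((dist x0 x)\<^sup>2 - real k)) \<longlonglongrightarrow> 0" by (rule tendsto_eventually)
      qed
    qed auto
    then show ?thesis by (simp add: E_def)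
  qed
  note second_moment = finite_second_moment[OF \<nu> sets_\<nu> ac H, of x0]
  note bound = W2_sq_le_discretised[OF \<nu> sets_\<nu> ac H, where z=z and ?x0.0=x0, folded E_def]
  \<comment> \<open>Any parameters give a finite bound; with \<open>n = 0\<close> the whole space is
    the leftover cell.\<close>
  have "W2_sq \<nu> \<mu> < \<infinity>"
    using le_less_trans[OF bound[of 1 1 0 0]] by simp
  then obtain W where W: "W2_sq \<nu> \<mu> = ennreal W" "0 \<le> W"
    by (metis infinity_ennreal_def ennreal_cases less_irrefl)
  define r where "r M \<epsilon> n = measure M {x. \<forall>k<n. \<epsilon> \<le> dist x (z k)}" for M :: "'a measure" and \<epsilon> n
  have E_nonneg: "0 \<le> E M R" for M R unfolding E_def by (rule integral_nonneg_AE) auto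
  have real_bound: "W \<le> (1 + \<theta>) * (C * H) + (1 + 1 / \<theta>) * (16 * \<epsilon>\<^sup>2)
     + 4 * real k * (r \<nu> \<epsilon> n + r \<mu> \<epsilon> n) + 2 * (E \<nu> (real k) + E \<mu> (real k))"
    if "\<theta> > 0" "\<epsilon> > 0" for \<theta> \<epsilon> k n
  proof -
    have "0 \<le> (1 + \<theta>) * (C * H) + (1 + 1 / \<theta>) * (16 * \<epsilon>\<^sup>2)
     + 4 * real k * (r \<nu> \<epsilon> n + r \<mu> \<epsilon> n) + 2 * (E \<nu> (real k) + E \<mu> (real k))"
      using that H_nonneg C_pos E_nonneg by (intro add_nonneg_nonneg mult_nonneg_nonneg) (auto simp: r_def)
    then show ?thesis
      using bound[OF that, of "real k" n] unfolding W by (simp add: r_def)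
  qed
  have step1: "W \<le> (1 + \<theta>) * (C * H) + (1 + 1 / \<theta>) * (16 * \<epsilon>\<^sup>2) + 2 * (E \<nu> (real k) + E \<mu> (real k))"
    if "\<theta> > 0" "\<epsilon> > 0" for \<theta> \<epsilon> k
  proof (rule tendsto_lowerbound[OF _ always_eventually])
    have "(\<lambda>n. r \<nu> \<epsilon> n) \<longlonglongrightarrow> 0" "(\<lambda>n. r \<mu> \<epsilon> n) \<longlonglongrightarrow> 0"
      unfolding r_def using rest[OF \<nu> sets_\<nu> that(2)] rest[OF prob_space_axioms sets_eq that(2)] by auto
    then show "(\<lambda>n. (1 + \<theta>) * (C * H) + (1 + 1 / \<theta>) * (16 * \<epsilon>\<^sup>2)
     + 4 * real k * (r \<nu> \<epsilon> n + r \<mu> \<epsilon> n) + 2 * (E \<nu> (real k) + E \<mu> (real k)))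
       \<longlonglongrightarrow> (1 + \<theta>) * (C * H) + (1 + 1 / \<theta>) * (16 * \<epsilon>\<^sup>2) + 2 * (E \<nu> (real k) + E \<mu> (real k))"
      by (auto intro!: tendsto_eq_intros)
    show "\<forall>n. W \<le> (1 + \<theta>) * (C * H) + (1 + 1 / \<theta>) * (16 * \<epsilon>\<^sup>2)
     + 4 * real k * (r \<nu> \<epsilon> n + r \<mu> \<epsilon> n) + 2 * (E \<nu> (real k) + E \<mu> (real k))"
      using real_bound[OF that] by blast
  qed simp
  have step2: "W \<le> (1 + \<theta>) * (C * H) + (1 + 1 / \<theta>) * (16 * \<epsilon>\<^sup>2)" if "\<theta> > 0" "\<epsilon> > 0" for \<theta> \<epsilon>
  proof (rule tendsto_lowerbound[OF _ always_eventually])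
    show "(\<lambda>k. (1 + \<theta>) * (C * H) + (1 + 1 / \<theta>) * (16 * \<epsilon>\<^sup>2) + 2 * (E \<nu> (real k) + E \<mu> (real k)))
       \<longlonglongrightarrow> (1 + \<theta>) * (C * H) + (1 + 1 / \<theta>) * (16 * \<epsilon>\<^sup>2)"
      using E_lim[OF sets_\<nu> second_moment(2)] E_lim[OF sets_eq second_moment(1)]
      by (auto intro!: tendsto_eq_intros)
    show "\<forall>k. W \<le> (1 + \<theta>) * (C * H) + (1 + 1 / \<theta>) * (16 * \<epsilon>\<^sup>2) + 2 * (E \<nu> (real k) + E \<mu> (real k))"
      using step1[OF that] by blast
  qed simp
  have step3: "W \<le> (1 + \<theta>) * (C * H)" if "\<theta> > 0" for \<theta>
  proof (rule tendsto_lowerbound)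
    show "((\<lambda>\<epsilon>. (1 + \<theta>) * (C * H) + (1 + 1 / \<theta>) * (16 * \<epsilon>\<^sup>2)) \<longlongrightarrow> (1 + \<theta>) * (C * H)) (at_right 0)"
      by (auto intro!: tendsto_eq_intros)
    show "\<forall>\<^sub>F \<epsilon> in at_right 0. W \<le> (1 + \<theta>) * (C * H) + (1 + 1 / \<theta>) * (16 * \<epsilon>\<^sup>2)"
      using eventually_at_right_less[of 0] by eventually_elim (rule step2[OF that])
  qed simp
  have "W \<le> C * H"
  proof (rule tendsto_lowerbound)
    show "((\<lambda>\<theta>. (1 + \<theta>) * (C * H)) \<longlongrightarrow> C * H) (at_right 0)"
      by (auto intro!: tendsto_eq_intros)
    show "\<forall>\<^sub>F \<theta> in at_right 0. W \<le> (1 + \<theta>) * (C * H)"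
      using eventually_at_right_less[of 0] by eventually_elim (rule step3)
  qed simp
  then show ?thesis by (simp add: W ennreal_leI)
qed

end

theorem theorem3p3:
  fixes \<mu> :: "'a::polish_space measure" and lam0 D :: real
  assumes "\<mu> \<in> prob_measures"
    and "lam0 > 0" and "D > 0"
    and "\<And>f. f \<in> F_class lam0 \<Longrightarrow>
           prob_space (density \<mu> (\<lambda>x. ennreal (exp (f x)))) \<Longrightarrow>
           rel_entropy \<mu> (density \<mu> (\<lambda>x. ennreal (exp (f x))))
             \<le> ereal D * enn2ereal (fisher_info \<mu> f)"
  shows "T2 (max (4 * D) (1 / lam0)) \<mu>"
proof -
  define C0 where "C0 = max (4 * D) (1 / lam0)"
  have C0: "C0 > 0" using assms by (simp add: C0_def less_max_iff_disj)
  interpret prob_space \<mu> using assms(1) by (simp add: prob_measures_def)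
  have lsi: "restricted_log_sobolev \<mu> lam0 D C" if "C > C0" for C
  proof unfold_locales
    show "sets \<mu> = sets borel" using assms(1) by (simp add: prob_measures_def)
    show "4 * D \<le> C" using that by (simp add: C0_def)
    have "1 / lam0 < C" "0 < C" using that C0 by (auto simp: C0_def)
    then show "1 / C < lam0" using assms(2) by (simp add: field_simps)
  qed (use assms in auto)
  show ?thesis
    unfolding T2_def C0_def[symmetric]
  proof
    fix \<nu> :: "'a measure" assume "\<nu> \<in> prob_measures"
    then have \<nu>: "prob_space \<nu>" "sets \<nu> = sets borel" by (auto simp: prob_measures_def)
    have sets_eq: "sets \<nu> = sets \<mu>" using \<nu> assms(1) by (simp add: prob_measures_def)
    show "enn2ereal (W2_sq \<nu> \<mu>) \<le> ereal C0 * rel_entropy \<mu> \<nu>"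
    proof (cases "rel_entropy \<mu> \<nu> = \<infinity>")
      case True
      then show ?thesis using C0 by simp
    next
      case False
      then have ac: "absolutely_continuous \<mu> \<nu>" by (metis rel_entropy_def)
      \<comment> \<open>The zero test function in \<open>donsker_varadhan\<close> gives the sign of
        the entropy.\<close>
      have "0 \<le> rel_entropy \<mu> \<nu>"
        using donsker_varadhan[OF \<nu>(1) sets_eq ac, of "\<lambda>_. 0" 0] by (simp add: prob_space zero_ereal_def)
      with False obtain H where H: "rel_entropy \<mu> \<nu> = ereal H" "0 \<le> H"
        by (cases "rel_entropy \<mu> \<nu>") auto
      have W: "W2_sq \<nu> \<mu> \<le> ennreal (C * H)" if "C > C0" for C
        by (rule restricted_log_sobolev.W2_sq_le_rel_entropy[OF lsi[OF that] \<nu> ac H])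
      have "W2_sq \<nu> \<mu> \<le> ennreal (C0 * H)"
      proof (rule tendsto_lowerbound)
        show "((\<lambda>C. ennreal (C * H)) \<longlongrightarrow> ennreal (C0 * H)) (at_right C0)"
          by (intro tendsto_ennrealI tendsto_intros)
        show "\<forall>\<^sub>F C in at_right C0. W2_sq \<nu> \<mu> \<le> ennreal (C * H)"
          using eventually_at_right_less[of C0] by eventually_elim (rule W)
      qed simp
      then have "enn2ereal (W2_sq \<nu> \<mu>) \<le> enn2ereal (ennreal (C0 * H))"
        by (simp add: less_eq_ennreal.rep_eq)
      then show ?thesis using C0 H by simp
    qed
  qed
qed

end
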